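(* Let $n\ge 3$, $\alpha\in(0,n)$ and $q>1$. Assume $u$ solves the integral equation $$u(x)=\int_{\mathbb{R}^n}g_\alpha(x-y)u^q(y)\,dy,\qquad u>0\text{ in }\mathbb{R}^n,$$ where $g_\alpha$ is the Bessel kernel of order $\alpha$. Then $u\in H^{\alpha/2}(\mathbb{R}^n)$ if and only if $u\in L^{q+1}(\mathbb{R}^n)$. In addition, $\|u\|_{H^{\alpha/2}(\mathbb{R}^n)}^2=\|u\|_{L^{q+1}(\mathbb{R}^n)}^{q+1}$.
   Context: The Bessel kernel $g_\alpha$ is the positive integrable function with Fourier transform $\hat g_\alpha(\xi)=(1+4\pi^2|\xi|^2)^{-\alpha/2}$, where $\hat f(\xi)=\int f(x)e^{-2\pi i x\cdot\xi}dx$. The norm of $H^{\alpha/2}(\mathbb{R}^n)$ is $\|u\|_{H^{\alpha/2}}^2=\int_{\mathbb{R}^n}(1+4\pi^2|\xi|^2)^{\alpha/2}|\hat u(\xi)|^2d\xi$. *)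

theory Defs
  imports "HOL-Analysis.Analysis"
begin

definition Lp :: "real \<Rightarrow> ('a::euclidean_space \<Rightarrow> 'b::real_normed_vector) set" where
  "Lp p = {f. f \<in> borel_measurable lborel \<and> integrable lborel (\<lambda>x. norm (f x) powr p)}"

definition Lp_norm :: "real \<Rightarrow> ('a::euclidean_space \<Rightarrow> 'b::real_normed_vector) \<Rightarrow> real" where
  "Lp_norm p f = (LINT x|lborel. norm (f x) powr p) powr (1 / p)"

definition fourier :: "('a::euclidean_space \<Rightarrow> complex) \<Rightarrow> 'a \<Rightarrow> complex" where
  "fourier f \<xi> = (LINT x|lborel. f x * exp (- 2 * of_real pi * \<i> * of_real (x \<bullet> \<xi>)))"

text \<open>The Fourier transform on \<open>L\<^sup>2\<close> is the continuous extension of \<^const>\<open>fourier\<close> from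
  \<open>L\<^sup>1 \<inter> L\<^sup>2\<close>. The value is determined almost everywhere, and is meaningful only for
  functions in \<open>L\<^sup>2\<close>. Distances are taken as extended nonnegative integrals, so that
  a non-integrable difference has distance \<open>\<infinity>\<close> and not 0.\<close>

definition is_fourier_L2 ::
    "('a::euclidean_space \<Rightarrow> complex) \<Rightarrow> ('a \<Rightarrow> complex) \<Rightarrow> bool" where
  "is_fourier_L2 u v \<longleftrightarrow> v \<in> Lp 2 \<and>
     (\<exists>f :: nat \<Rightarrow> 'a \<Rightarrow> complex. (\<forall>k. f k \<in> Lp 1 \<inter> Lp 2) \<and>
        (\<lambda>k. \<integral>\<^sup>+x. ennreal ((norm (f k x - u x))\<^sup>2) \<partial>lborel) \<longlonglongrightarrow> 0 \<and>
        (\<lambda>k. \<integral>\<^sup>+\<xi>. ennreal ((norm (fourier (f k) \<xi> - v \<xi>))\<^sup>2) \<partial>lborel) \<longlonglongrightarrow> 0)"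

definition fourier_L2 :: "('a::euclidean_space \<Rightarrow> complex) \<Rightarrow> 'a \<Rightarrow> complex" where
  "fourier_L2 u = (SOME v. is_fourier_L2 u v)"

text \<open>The spaces \<open>H\<^sup>s\<close> for \<open>s \<ge> 0\<close>, which are contained in \<open>L\<^sup>2\<close>.\<close>

definition sobolev :: "real \<Rightarrow> ('a::euclidean_space \<Rightarrow> complex) set" where
  "sobolev s = {u \<in> Lp 2. integrable lborel
     (\<lambda>\<xi>. (1 + 4 * pi\<^sup>2 * (norm \<xi>)\<^sup>2) powr s * (norm (fourier_L2 u \<xi>))\<^sup>2)}"

definition sobolev_norm :: "real \<Rightarrow> ('a::euclidean_space \<Rightarrow> complex) \<Rightarrow> real" where
  "sobolev_norm s u = sqrt (LINT \<xi>|lborel.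
     (1 + 4 * pi\<^sup>2 * (norm \<xi>)\<^sup>2) powr s * (norm (fourier_L2 u \<xi>))\<^sup>2)"

text \<open>The Bessel kernel is determined by its Fourier transform up to a null set.
  For \<open>\<alpha> \<le> n\<close> it is unbounded at the origin, so no condition is put on the value there.\<close>

definition bessel_kernel :: "real \<Rightarrow> ('a::euclidean_space \<Rightarrow> real) \<Rightarrow> bool" where
  "bessel_kernel \<alpha> g \<longleftrightarrow>
     integrable lborel g \<and> (\<forall>x. x \<noteq> 0 \<longrightarrow> 0 < g x) \<and>
     (\<forall>\<xi>. fourier (\<lambda>x. complex_of_real (g x)) \<xi> =
        of_real ((1 + 4 * pi\<^sup>2 * (norm \<xi>)\<^sup>2) powr (- \<alpha> / 2)))"

end

theory Submission
  imports Defs "HOL-Probability.Characteristic_Functions"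
begin

text \<open>
  Let \<open>w\<^sub>k\<close> be bounded truncations of bounded support increasing to \<open>u\<^sup>q\<close>, let \<open>u\<^sub>k = g * w\<^sub>k\<close>, and
  write \<open>m\<close> for the Fourier transform of \<open>g\<close>, so that \<open>0 < m \<le> 1\<close>. By monotone convergence
  \<open>u\<^sub>k\<close> increases to \<open>u\<close>, and by Plancherel the energies
  \<open>a\<^sub>k = \<integral> u\<^sub>k w\<^sub>k = \<integral> m \<bar>fourier w\<^sub>k\<bar>\<^sup>2 = \<integral> m\<^sup>-\<^sup>1 \<bar>fourier u\<^sub>k\<bar>\<^sup>2\<close> increase to \<open>A = \<integral> u\<^sup>q\<^sup>+\<^sup>1\<close>.
  Put \<open>C = \<integral> m\<^sup>-\<^sup>1 \<bar>fourier u\<bar>\<^sup>2\<close>, the squared Sobolev norm of \<open>u\<close>.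

  If \<open>C\<close> is finite, Parseval gives
  \<open>a\<^sub>k \<le> \<integral> u w\<^sub>k = Re \<integral> fourier u \<cdot> cnj (fourier w\<^sub>k) \<le> (C + a\<^sub>k) / 2\<close>, hence \<open>A \<le> C\<close>. If \<open>A\<close> is
  finite, then \<open>\<parallel>u\<^sub>k\<parallel>\<^sup>2 \<le> a\<^sub>k \<le> A\<close> because \<open>m \<le> 1\<close>, so \<open>u\<^sub>k\<close> converges to \<open>u\<close> in \<open>L\<^sup>2\<close>, and Fatou's
  lemma along a subsequence of \<open>fourier u\<^sub>k\<close> gives \<open>C \<le> A\<close>.
\<close>

section \<open>Affine changes of variables and the Gaussian\<close>

lemma lborel_nn_integral_affine:
  fixes f :: "'a::euclidean_space \<Rightarrow> ennreal"
  assumes [measurable]: "f \<in> borel_measurable borel" and c: "c \<noteq> 0"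
  shows "(\<integral>\<^sup>+x. f x \<partial>lborel) = ennreal (\<bar>c\<bar> ^ DIM('a)) * (\<integral>\<^sup>+x. f (t + c *\<^sub>R x) \<partial>lborel)"
  by (subst lborel_affine[OF c, of t])
     (simp add: nn_integral_density nn_integral_distr nn_integral_cmult)

lemma lborel_integrable_affine:
  fixes f :: "'a::euclidean_space \<Rightarrow> 'b :: {banach, second_countable_topology}"
  assumes f: "integrable lborel f" and c: "c \<noteq> 0"
  shows "integrable lborel (\<lambda>x. f (t + c *\<^sub>R x))"
proof -
  have [measurable]: "f \<in> borel_measurable borel"
    using f by auto
  show ?thesis
    using f lborel_nn_integral_affine[of "\<lambda>x. ennreal (norm (f x))" c t] c
    unfolding integrable_iff_bounded by (auto simp: ennreal_mult_less_top)
qed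

text \<open>The converse direction is the forward one applied to the inverse affine map. The
  equivalence is what lets the next lemma cover non-integrable functions.\<close>

lemma lborel_integrable_affine_iff:
  fixes f :: "'a::euclidean_space \<Rightarrow> 'b :: {banach, second_countable_topology}"
  assumes c: "c \<noteq> 0"
  shows "integrable lborel (\<lambda>x. f (t + c *\<^sub>R x)) \<longleftrightarrow> integrable lborel f"
  using c lborel_integrable_affine[of f c t]
    lborel_integrable_affine[of "\<lambda>x. f (t + c *\<^sub>R x)" "1/c" "- (1/c) *\<^sub>R t"]
  by (auto simp: algebra_simps)

lemma lborel_integral_affine:
  fixes f :: "'a::euclidean_space \<Rightarrow> 'b :: {banach, second_countable_topology}"
  assumes c: "c \<noteq> 0"
  shows "(LINT x|lborel. f x) = \<bar>c\<bar> ^ DIM('a) *\<^sub>R (LINT x|lborel. f (t + c *\<^sub>R x))"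
proof (cases "integrable lborel f")
  case True
  then have [measurable]: "f \<in> borel_measurable borel"
    by auto
  show ?thesis
    by (subst lborel_affine[OF c, of t]) (simp add: integral_density integral_distr)
next
  case False
  \<comment> \<open>Integrability fails on both sides together, so both Bochner integrals take the
    default value 0.\<close>
  then show ?thesis
    using lborel_integrable_affine_iff[OF c, of f t] by (simp add: not_integrable_integral_eq)
qed

lemma lborel_integral_translation:
  fixes f :: "'a::euclidean_space \<Rightarrow> 'b :: {banach, second_countable_topology}"
  shows "(LINT x|lborel. f (t + x)) = (LINT x|lborel. f x)"
  using lborel_integral_affine[of 1 f t] by simp

lemma lborel_integral_reflection:
  fixes f :: "'a::euclidean_space \<Rightarrow> 'b :: {banach, second_countable_topology}"
  shows "(LINT x|lborel. f (t - x)) = (LINT x|lborel. f x)"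
  using lborel_integral_affine[of "-1" f t] by simp

lemma lborel_integrable_translation:
  fixes f :: "'a::euclidean_space \<Rightarrow> 'b :: {banach, second_countable_topology}"
  shows "integrable lborel f \<Longrightarrow> integrable lborel (\<lambda>x. f (t + x))"
  using lborel_integrable_affine[of f 1 t] by simp

lemma lborel_integrable_reflection:
  fixes f :: "'a::euclidean_space \<Rightarrow> 'b :: {banach, second_countable_topology}"
  shows "integrable lborel f \<Longrightarrow> integrable lborel (\<lambda>x. f (t - x))"
  using lborel_integrable_affine[of f "-1" t] by simp

text \<open>Up to a constant this Gaussian is the standard normal density rescaled by
  \<open>sqrt (2 * pi)\<close>, so its transform is read off from the characteristic function of the
  normal distribution.\<close>

lemma gaussian_fourier_real:
  fixes y :: real
  shows "integrable lborel (\<lambda>x. exp (- pi * x\<^sup>2))"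
    and "(LINT x|lborel. complex_of_real (exp (- pi * x\<^sup>2)) * exp (- 2 * of_real pi * \<i> * of_real (x * y)))
       = of_real (exp (- pi * y\<^sup>2))"
proof -
  let ?c = "sqrt (2 * pi)"
  have c: "?c > 0" by simp
  have E: "exp (- pi * x\<^sup>2) = ?c * std_normal_density (0 + ?c * x)" for x
    by (simp add: std_normal_density_def power_mult_distrib)
  have "integrable lborel (\<lambda>x. ?c * std_normal_density (0 + ?c * x))"
    by (intro integrable_mult_right lborel_integrable_real_affine integrable_normal_density) auto
  then show "integrable lborel (\<lambda>x. exp (- pi * x\<^sup>2))"
    by (simp only: E)
  \<comment> \<open>The frequency \<open>- ?c * y\<close> makes \<open>exp (- t\<^sup>2 / 2)\<close>
    equal to the target; after the substitution by \<open>?c * x\<close> the two factors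
    \<open>?c\<close> combine to the \<open>2 * pi\<close> of the Fourier character.\<close>
  have "of_real (exp (- pi * y\<^sup>2)) = char std_normal_distribution (- ?c * y)"
    by (simp add: char_std_normal_distribution power_mult_distrib)
  also have "\<dots> = (LINT x|lborel. std_normal_density x *\<^sub>R iexp (- ?c * y * x))"
    unfolding char_def by (subst integral_density) auto
  also have "\<dots> = ?c *\<^sub>R (LINT x|lborel. std_normal_density (0 + ?c * x) *\<^sub>R iexp (- ?c * y * (0 + ?c * x)))"
    by (subst lborel_integral_real_affine[of ?c _ 0]) auto
  also have "\<dots> = (LINT x|lborel. complex_of_real (exp (- pi * x\<^sup>2)) * exp (- 2 * of_real pi * \<i> * of_real (x * y)))"
  proof -
    have [simp]: "complex_of_real ?c * (complex_of_real ?c * z) = 2 * of_real pi * z" for z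
      unfolding mult.assoc[symmetric] of_real_mult[symmetric] by (simp del: of_real_mult) simp
    show ?thesis
      by (subst integral_scaleR_right[symmetric], intro Bochner_Integration.integral_cong refl, subst E)
         (simp add: scaleR_conv_of_real mult_ac)
  qed
  finally show "(LINT x|lborel. complex_of_real (exp (- pi * x\<^sup>2)) * exp (- 2 * of_real pi * \<i> * of_real (x * y)))
       = of_real (exp (- pi * y\<^sup>2))" by simp
qed

text \<open>Lebesgue measure is the image of the product measure on coordinates, and both the
  Gaussian and the character are products over coordinates, so Fubini for finite products reduces
  everything to dimension one.\<close>

lemma gaussian_fourier:
  shows "integrable lborel (\<lambda>x::'a::euclidean_space. exp (- pi * (norm x)\<^sup>2))"
    and "fourier (\<lambda>x::'a. complex_of_real (exp (- pi * (norm x)\<^sup>2))) \<xi> = of_real (exp (- pi * (norm \<xi>)\<^sup>2))"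
proof -
  interpret product_sigma_finite "\<lambda>_::'a. lborel :: real measure"
    by (simp add: product_sigma_finite_def sigma_finite_lborel)
  have nrm: "exp (- pi * (norm x)\<^sup>2) = (\<Prod>b\<in>Basis. exp (- pi * (x \<bullet> b)\<^sup>2))" for x :: 'a
    by (simp add: exp_sum[symmetric] sum_distrib_left[symmetric] sum_negf)
       (metis (no_types, lifting) euclidean_inner power2_eq_square power2_norm_eq_inner sum.cong)
  let ?T = "\<lambda>f::'a\<Rightarrow>real. \<Sum>b\<in>Basis. f b *\<^sub>R b"
  have T[simp]: "b \<in> Basis \<Longrightarrow> ?T f \<bullet> b = f b" for f b
    by (simp add: inner_sum_left inner_Basis if_distrib cong: if_cong)
  have I: "integrable lborel (\<lambda>x::'a. exp (- pi * (norm x)\<^sup>2))"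
  proof (subst lborel_eq, subst integrable_distr_eq)
    show "integrable (Pi\<^sub>M Basis (\<lambda>b::'a. lborel)) (\<lambda>f. exp (- pi * (norm (?T f))\<^sup>2))"
      unfolding nrm using product_integrable_prod[of Basis "\<lambda>_ x. exp (- pi * x\<^sup>2)",
          OF finite_Basis gaussian_fourier_real(1)]
      by (simp cong: prod.cong)
  qed auto
  show "integrable lborel (\<lambda>x::'a. exp (- pi * (norm x)\<^sup>2))" by fact
  let ?h = "\<lambda>b x. complex_of_real (exp (- pi * x\<^sup>2)) * exp (- 2 * of_real pi * \<i> * of_real (x * (\<xi> \<bullet> b)))"
  have h: "complex_of_real (exp (- pi * (norm x)\<^sup>2)) * exp (- 2 * of_real pi * \<i> * of_real (x \<bullet> \<xi>))
     = (\<Prod>b\<in>Basis. ?h b (x \<bullet> b))" for x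
    unfolding prod.distrib nrm of_real_prod
    by (subst euclidean_inner) (simp add: exp_sum[symmetric] sum_distrib_left[symmetric] sum_negf)
  have hi: "integrable lborel (?h b)" for b
    by (rule Bochner_Integration.integrable_bound[OF gaussian_fourier_real(1)]) (auto simp: norm_mult)
  have "fourier (\<lambda>x::'a. complex_of_real (exp (- pi * (norm x)\<^sup>2))) \<xi>
    = (LINT f|Pi\<^sub>M Basis (\<lambda>b::'a. lborel). (\<Prod>b\<in>Basis. ?h b (?T f \<bullet> b)))"
    unfolding fourier_def h by (subst lborel_eq, subst integral_distr) auto
  also have "\<dots> = (LINT f|Pi\<^sub>M Basis (\<lambda>b::'a. lborel). (\<Prod>b\<in>Basis. ?h b (f b)))"
    by (simp cong: prod.cong)
  also have "\<dots> = (\<Prod>b\<in>Basis. LINT x|lborel. ?h b x)"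
    by (rule product_integral_prod) (simp, rule hi)
  also have "\<dots> = (\<Prod>b\<in>Basis. of_real (exp (- pi * (\<xi> \<bullet> b)\<^sup>2)))"
    unfolding gaussian_fourier_real(2) by simp
  also have "\<dots> = of_real (exp (- pi * (norm \<xi>)\<^sup>2))"
    unfolding nrm by simp
  finally show "fourier (\<lambda>x::'a. complex_of_real (exp (- pi * (norm x)\<^sup>2))) \<xi> = of_real (exp (- pi * (norm \<xi>)\<^sup>2))" .
qed

section \<open>Convolution and translation\<close>

abbreviation fourier_char :: "'a::euclidean_space \<Rightarrow> 'a \<Rightarrow> complex" where
  "fourier_char \<xi> x \<equiv> exp (- 2 * of_real pi * \<i> * of_real (x \<bullet> \<xi>))"

lemma fourier_char_add: "fourier_char \<xi> (x + y) = fourier_char \<xi> x * fourier_char \<xi> y"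
  by (simp add: inner_add_left algebra_simps exp_add[symmetric])

lemma integrable_mult_fourier_char:
  assumes "integrable lborel f"
  shows "integrable lborel (\<lambda>x. f x * fourier_char \<xi> x)"
  by (rule Bochner_Integration.integrable_bound[OF assms])
     (use borel_measurable_integrable[OF assms] in \<open>auto simp: norm_mult\<close>)

lemma borel_measurable_fourier:
  assumes [measurable]: "f \<in> borel_measurable borel"
  shows "fourier f \<in> borel_measurable borel"
  unfolding fourier_def[abs_def] by measurable

lemma fourier_diff:
  assumes "integrable lborel f" "integrable lborel g"
  shows "fourier (\<lambda>x. f x - g x) \<xi> = fourier f \<xi> - fourier g \<xi>"
  unfolding fourier_def left_diff_distrib
  by (intro Bochner_Integration.integral_diff integrable_mult_fourier_char assms)

text \<open>Tonelli: integrating in \<open>x\<close> first, translation invariance removes the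
  dependence on \<open>y\<close>, and the double integral becomes the product of the two L^1
  norms.\<close>

lemma integrable_convolution_kernel:
  fixes f g :: "'a::euclidean_space \<Rightarrow> 'b::{real_normed_field,banach,second_countable_topology}"
  assumes f: "integrable lborel f" and g: "integrable lborel g"
  shows "integrable (lborel \<Otimes>\<^sub>M lborel) (\<lambda>(x, y). f (x - y) * g y)"
proof (rule integrableI_bounded)
  have [measurable]: "f \<in> borel_measurable borel" "g \<in> borel_measurable borel"
    using f g by auto
  show "(\<lambda>(x, y). f (x - y) * g y) \<in> borel_measurable (lborel \<Otimes>\<^sub>M lborel)"
    by measurable
  have "(\<integral>\<^sup>+p. ennreal (norm (case p of (x, y) \<Rightarrow> f (x - y) * g y)) \<partial>(lborel \<Otimes>\<^sub>M lborel))
     = (\<integral>\<^sup>+y. \<integral>\<^sup>+x. ennreal (norm (f (x - y))) * ennreal (norm (g y)) \<partial>lborel \<partial>lborel)"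
    by (subst lborel_pair.nn_integral_snd[symmetric]) (auto simp: norm_mult ennreal_mult)
  also have "\<dots> = (\<integral>\<^sup>+y. (\<integral>\<^sup>+x. ennreal (norm (f x)) \<partial>lborel) * ennreal (norm (g y)) \<partial>lborel)"
  proof (intro nn_integral_cong)
    fix y
    show "(\<integral>\<^sup>+x. ennreal (norm (f (x - y))) * ennreal (norm (g y)) \<partial>lborel)
      = (\<integral>\<^sup>+x. ennreal (norm (f x)) \<partial>lborel) * ennreal (norm (g y))"
      by (subst lborel_nn_integral_affine[of "\<lambda>x. ennreal (norm (f x))" 1 "-y"])
         (simp_all add: nn_integral_multc)
  qed
  also have "\<dots> = (\<integral>\<^sup>+x. ennreal (norm (f x)) \<partial>lborel) * (\<integral>\<^sup>+y. ennreal (norm (g y)) \<partial>lborel)"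
    by (simp add: nn_integral_cmult)
  also have "\<dots> < \<infinity>"
    using f g unfolding integrable_iff_bounded by (auto simp: ennreal_mult_less_top)
  finally show "(\<integral>\<^sup>+p. ennreal (norm (case p of (x, y) \<Rightarrow> f (x - y) * g y)) \<partial>(lborel \<Otimes>\<^sub>M lborel)) < \<infinity>" .
qed

lemma integrable_convolution:
  fixes f g :: "'a::euclidean_space \<Rightarrow> 'b::{real_normed_field,banach,second_countable_topology}"
  assumes f: "integrable lborel f" and g: "integrable lborel g"
  shows "integrable lborel (\<lambda>x. LINT y|lborel. f (x - y) * g y)"
  using lborel_pair.integrable_fst[OF integrable_convolution_kernel[OF f g]] by simp

text \<open>The character is multiplicative along \<open>x = (x - y) + y\<close>, so after Fubini
  the inner integral in \<open>x\<close> is \<open>fourier f \<xi>\<close> for every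
  \<open>y\<close>.\<close>

lemma fourier_convolution:
  assumes f: "integrable lborel f" and g: "integrable lborel g"
  shows "fourier (\<lambda>x. LINT y|lborel. f (x - y) * g y) \<xi> = fourier f \<xi> * fourier g \<xi>"
proof -
  let ?e = "fourier_char \<xi>"
  have split: "f (x - y) * g y * ?e x = f (x - y) * ?e (x - y) * (g y * ?e y)" for x y
    using fourier_char_add[of "x - y" y \<xi>] by (simp add: mult_ac)
  have I: "integrable (lborel \<Otimes>\<^sub>M lborel) (\<lambda>(x, y). f (x - y) * ?e (x - y) * (g y * ?e y))"
    by (intro integrable_convolution_kernel integrable_mult_fourier_char assms)
  have tr: "(LINT x|lborel. f (x - y) * ?e (x - y)) = fourier f \<xi>" for y
    using lborel_integral_translation[of "\<lambda>x. f x * ?e x" "-y"] by (simp add: fourier_def)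
  have "fourier (\<lambda>x. LINT y|lborel. f (x - y) * g y) \<xi>
      = (LINT x|lborel. LINT y|lborel. f (x - y) * ?e (x - y) * (g y * ?e y))"
    unfolding fourier_def split[symmetric] by simp
  also have "\<dots> = (LINT y|lborel. LINT x|lborel. f (x - y) * ?e (x - y) * (g y * ?e y))"
    by (rule lborel_pair.Fubini_integral[symmetric, OF I])
  also have "\<dots> = (LINT y|lborel. fourier f \<xi> * (g y * ?e y))"
    by (simp only: integral_mult_left_zero tr)
  also have "\<dots> = fourier f \<xi> * fourier g \<xi>"
    by (simp add: fourier_def)
  finally show ?thesis .
qed

text \<open>Both sides are iterated integrals of the same function, because the kernel of the
  transform is symmetric in its two variables.\<close>

lemma fourier_multiplication_formula:
  assumes f: "integrable lborel f" and g: "integrable lborel g"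
  shows "(LINT x|lborel. f x * fourier g x) = (LINT x|lborel. fourier f x * g x)"
proof -
  have [measurable]: "f \<in> borel_measurable borel" "g \<in> borel_measurable borel"
    using f g by auto
  have "integrable (lborel \<Otimes>\<^sub>M lborel) (\<lambda>(x, y). f x * g y)"
  proof (rule lborel_pair.Fubini_integrable)
    show "integrable lborel (\<lambda>x. LINT y|lborel. norm (case (x, y) of (x, y) \<Rightarrow> f x * g y))"
      using f by (simp add: norm_mult)
    show "AE x in lborel. integrable lborel (\<lambda>y. case (x, y) of (x, y) \<Rightarrow> f x * g y)"
      using g by simp
  qed measurable
  then have I: "integrable (lborel \<Otimes>\<^sub>M lborel) (\<lambda>(x, y). f x * g y * fourier_char x y)"
    by (rule Bochner_Integration.integrable_bound) (auto simp: norm_mult)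
  have "(LINT x|lborel. f x * fourier g x) = (LINT x|lborel. LINT y|lborel. f x * g y * fourier_char x y)"
    by (simp add: fourier_def mult.assoc)
  also have "\<dots> = (LINT y|lborel. LINT x|lborel. f x * g y * fourier_char x y)"
    by (rule lborel_pair.Fubini_integral[symmetric, OF I])
  also have "\<dots> = (LINT y|lborel. fourier f y * g y)"
    unfolding fourier_def by (subst integral_mult_left_zero[symmetric]) (simp add: inner_commute mult_ac)
  finally show ?thesis .
qed

text \<open>A density argument by induction on integrable functions: indicators of open sets are
  treated directly, general indicators by outer regularity, and sums and limits by the triangle
  inequality.\<close>

lemma L1_translation_tendsto_0:
  fixes f :: "'a::euclidean_space \<Rightarrow> 'b::{banach,second_countable_topology}"
  assumes "integrable lborel f" and "h \<longlonglongrightarrow> 0"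
  shows "(\<lambda>k. LINT x|lborel. norm (f (h k + x) - f x)) \<longlonglongrightarrow> 0"
proof -
  \<comment> \<open>The approximation error is the same for all translates.\<close>
  have approx: "(\<lambda>k. LINT x|lborel. norm (f (h k + x) - f x)) \<longlonglongrightarrow> 0"
    if f: "integrable lborel f"
      and ap: "\<And>e. e > 0 \<Longrightarrow> \<exists>g. integrable lborel g \<and> (LINT x|lborel. norm (f x - g x)) < e \<and>
             (\<lambda>k. LINT x|lborel. norm (g (h k + x) - g x)) \<longlonglongrightarrow> 0"
    for f :: "'a \<Rightarrow> 'b"
  proof (rule LIMSEQ_I)
    fix e :: real assume "e > 0"
    then obtain g where g: "integrable lborel g" and fg: "(LINT x|lborel. norm (f x - g x)) < e / 3"
      and lim: "(\<lambda>k. LINT x|lborel. norm (g (h k + x) - g x)) \<longlonglongrightarrow> 0"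
      using ap[of "e / 3"] by auto
    obtain N where N: "\<And>k. k \<ge> N \<Longrightarrow> norm ((LINT x|lborel. norm (g (h k + x) - g x)) - 0) < e / 3"
      using LIMSEQ_D[OF lim, of "e / 3"] \<open>e > 0\<close> by auto
    have "norm ((LINT x|lborel. norm (f (h k + x) - f x)) - 0) < e" if "k \<ge> N" for k
    proof -
      note [simp] = f g lborel_integrable_translation[OF f, of "h k"] lborel_integrable_translation[OF g, of "h k"]
      have i1: "integrable lborel (\<lambda>x. norm (f (h k + x) - g (h k + x)))" by auto
      have i2: "integrable lborel (\<lambda>x. norm (g (h k + x) - g x))" by auto
      have i3: "integrable lborel (\<lambda>x. norm (f x - g x))" by auto
      have "(LINT x|lborel. norm (f (h k + x) - f x)) \<le>
         (LINT x|lborel. norm (f (h k + x) - g (h k + x)) + norm (g (h k + x) - g x) + norm (f x - g x))"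
      proof (rule integral_mono)
        show "integrable lborel (\<lambda>x. norm (f (h k + x) - f x))" by auto
        fix x show "norm (f (h k + x) - f x) \<le>
          norm (f (h k + x) - g (h k + x)) + norm (g (h k + x) - g x) + norm (f x - g x)"
          by norm
      qed (intro Bochner_Integration.integrable_add i1 i2 i3)
      also have "\<dots> = (LINT x|lborel. norm (f (h k + x) - g (h k + x))) +
          (LINT x|lborel. norm (g (h k + x) - g x)) + (LINT x|lborel. norm (f x - g x))"
        using i1 i2 i3 by simp
      also have "(LINT x|lborel. norm (f (h k + x) - g (h k + x))) = (LINT x|lborel. norm (f x - g x))"
        by (rule lborel_integral_translation[of "\<lambda>x. norm (f x - g x)"])
      finally show ?thesis
        using fg N[OF that] by simp
    qed
    then show "\<exists>N. \<forall>k\<ge>N. norm ((LINT x|lborel. norm (f (h k + x) - f x)) - 0) < e" by blast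
  qed
  \<comment> \<open>A set and its translate have equal measure, so the symmetric difference has
    twice the measure of the part of \<open>U\<close> that the translation moves out of
    \<open>U\<close>. Openness makes the indicator of that part tend to 0 at every point.\<close>
  have open_case: "(\<lambda>k. LINT x|lborel. norm (indicator U (h k + x) *\<^sub>R c - indicator U x *\<^sub>R c)) \<longlonglongrightarrow> 0"
    if U: "open U" "emeasure lborel U < \<infinity>" for U and c :: 'b
  proof -
    note [measurable] = borel_open[OF U(1)]
    have iU: "integrable lborel (indicator U :: 'a \<Rightarrow> real)" using U by simp
    let ?d = "\<lambda>k x. indicator U x - indicator U x * indicator U (h k + x) :: real"
    have id: "integrable lborel (\<lambda>x. indicator U x * indicator U (h k + x) :: real)" for k
      by (rule Bochner_Integration.integrable_bound[OF iU]) (auto split: split_indicator)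
    have "(LINT x|lborel. norm (indicator U (h k + x) *\<^sub>R c - indicator U x *\<^sub>R c))
       = (LINT x|lborel. (indicator U (h k + x) + indicator U x
             - 2 * (indicator U x * indicator U (h k + x))) * norm c)" for k
      by (intro Bochner_Integration.integral_cong) (auto split: split_indicator)
    also have "\<dots> k = 2 * (LINT x|lborel. ?d k x) * norm c" for k
      using iU id lborel_integral_translation[of "indicator U :: _ \<Rightarrow> real" "h k"]
        lborel_integrable_translation[OF iU, of "h k"] by simp
    finally have eq: "(LINT x|lborel. norm (indicator U (h k + x) *\<^sub>R c - indicator U x *\<^sub>R c))
       = 2 * (LINT x|lborel. ?d k x) * norm c" for k .
    have "(\<lambda>k. LINT x|lborel. ?d k x) \<longlonglongrightarrow> (LINT x::'a|lborel. 0)"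
    proof (rule integral_dominated_convergence[OF _ _ iU])
      show "AE x in lborel. (\<lambda>k. ?d k x) \<longlonglongrightarrow> 0"
      proof (rule AE_I2)
        fix x
        have "eventually (\<lambda>k. ?d k x = 0) sequentially"
        proof (cases "x \<in> U")
          case True
          have "(\<lambda>k. h k + x) \<longlonglongrightarrow> x"
            using tendsto_add[OF assms(2) tendsto_const[of x]] by simp
          then have "eventually (\<lambda>k. h k + x \<in> U) sequentially"
            by (rule topological_tendstoD) (use U True in auto)
          then show ?thesis by eventually_elim (auto split: split_indicator)
        qed auto
        then show "(\<lambda>k. ?d k x) \<longlonglongrightarrow> 0"
          by (rule tendsto_eventually)
      qed
    qed (auto split: split_indicator)
    then have "(\<lambda>k. 2 * (LINT x|lborel. ?d k x) * norm c) \<longlonglongrightarrow> 2 * 0 * norm c"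
      by (intro tendsto_intros) simp
    then show ?thesis unfolding eq by simp
  qed
  from \<open>integrable lborel f\<close> show ?thesis
  proof (induction f rule: integrable_induct)
    case (base A c)
    then have A[measurable]: "A \<in> sets borel" and fin: "emeasure lborel A < \<infinity>" by auto
    show ?case
    proof (rule approx)
      show "integrable lborel (\<lambda>x. indicator A x *\<^sub>R c)" using fin by simp
      fix e :: real assume e: "e > 0"
      \<comment> \<open>The summand 1 keeps the denominator positive when
        \<open>c = 0\<close>.\<close>
      let ?e = "e / (norm c + 1)"
      have nc: "norm c + 1 > 0" by (simp add: add_nonneg_pos)
      have e': "?e > 0" using e nc by simp
      obtain U where U: "open U" "A \<subseteq> U" "emeasure lborel (U - A) < ?e"
        using outer_regular_lborel[OF A e'] .
      note [measurable] = borel_open[OF U(1)]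
      have "emeasure lborel U = emeasure lborel A + emeasure lborel (U - A)"
        using U(2) by (subst plus_emeasure) (auto intro!: arg_cong[where f="emeasure lborel"])
      also have "\<dots> < \<infinity>" using fin U(3) by (auto simp: less_top[symmetric])
      finally have Ufin: "emeasure lborel U < \<infinity>" .
      have fm: "emeasure lborel (U - A) = ennreal (measure lborel (U - A))"
        using U(3) by (intro emeasure_eq_ennreal_measure) auto
      have "(LINT x|lborel. norm (indicator A x *\<^sub>R c - indicator U x *\<^sub>R c))
         = (LINT x|lborel. indicator (U - A) x * norm c)"
        using U(2) by (intro Bochner_Integration.integral_cong) (auto split: split_indicator)
      also have "\<dots> = measure lborel (U - A) * norm c"
        by simp
      also have "\<dots> \<le> measure lborel (U - A) * (norm c + 1)"
        by (intro mult_left_mono) auto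
      also have "\<dots> < e"
        using U(3) e nc unfolding fm by (simp add: ennreal_less_iff pos_less_divide_eq)
      finally show "\<exists>g. integrable lborel g \<and> (LINT x|lborel. norm (indicator A x *\<^sub>R c - g x)) < e \<and>
             (\<lambda>k. LINT x|lborel. norm (g (h k + x) - g x)) \<longlonglongrightarrow> 0"
        using open_case[OF U(1) Ufin, of c] Ufin
        by (intro exI[of _ "\<lambda>x. indicator U x *\<^sub>R c"]) auto
    qed
  next
    case (add f g)
    have "(\<lambda>k. (LINT x|lborel. norm (f (h k + x) - f x)) + (LINT x|lborel. norm (g (h k + x) - g x))) \<longlonglongrightarrow> 0"
      using tendsto_add[OF add.IH] by simp
    then show ?case
    proof (rule tendsto_sandwich[OF _ _ tendsto_const, rotated 2])
      show "\<forall>\<^sub>F k in sequentially. (LINT x|lborel. norm (f (h k + x) + g (h k + x) - (f x + g x)))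
        \<le> (LINT x|lborel. norm (f (h k + x) - f x)) + (LINT x|lborel. norm (g (h k + x) - g x))"
      proof (intro always_eventually allI)
        fix k
        note [simp] = add.hyps lborel_integrable_translation[OF add.hyps(1), of "h k"]
          lborel_integrable_translation[OF add.hyps(2), of "h k"]
        have i: "integrable lborel (\<lambda>x. norm (f (h k + x) - f x))"
          "integrable lborel (\<lambda>x. norm (g (h k + x) - g x))" by auto
        have "(LINT x|lborel. norm (f (h k + x) + g (h k + x) - (f x + g x)))
           \<le> (LINT x|lborel. norm (f (h k + x) - f x) + norm (g (h k + x) - g x))"
          by (intro integral_mono) (auto intro: norm_diff_triangle_ineq)
        then show "(LINT x|lborel. norm (f (h k + x) + g (h k + x) - (f x + g x)))
        \<le> (LINT x|lborel. norm (f (h k + x) - f x)) + (LINT x|lborel. norm (g (h k + x) - g x))"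
          using i by simp
      qed
    qed auto
  next
    case (lim f s)
    show ?case
    proof (rule approx[OF lim.hyps(4)])
      fix e :: real assume "e > 0"
      have "(\<lambda>i. LINT x|lborel. norm (f x - s i x)) \<longlonglongrightarrow> (LINT x::'a|lborel. 0)"
      \<comment> \<open>The factor 3 is 1 for \<open>f\<close> plus 2 from the bound
        \<open>norm (s i x) \<le> 2 * norm (f x)\<close> of the induction rule.\<close>
      proof (rule integral_dominated_convergence[where w="\<lambda>x. 3 * norm (f x)"])
        show "AE x in lborel. (\<lambda>i. norm (f x - s i x)) \<longlonglongrightarrow> 0"
          using lim.hyps(2) by (auto intro!: AE_I2 tendsto_eq_intros)
        show "AE x in lborel. norm (norm (f x - s i x)) \<le> 3 * norm (f x)" for i
          using lim.hyps(3)[of _ i] by (auto intro!: AE_I2 order.trans[OF norm_triangle_ineq4])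
      qed (use lim.hyps in auto)
      then obtain i where "norm ((LINT x|lborel. norm (f x - s i x)) - 0) < e"
        using LIMSEQ_D[of _ 0, OF _ \<open>e > 0\<close>] by fastforce
      then show "\<exists>g. integrable lborel g \<and> (LINT x|lborel. norm (f x - g x)) < e \<and>
             (\<lambda>k. LINT x|lborel. norm (g (h k + x) - g x)) \<longlonglongrightarrow> 0"
        using lim.hyps(1) lim.IH by (intro exI[of _ "s i"]) auto
    qed
  qed
qed

section \<open>Plancherel on \<open>L\<^sup>1 \<inter> L\<^sup>2\<close>\<close>

text \<open>Pair the difference on the right with \<open>a - b\<close>: the inner product is at
  least \<open>(norm a + norm b) / 2\<close> times the left side, and Cauchy-Schwarz bounds it from
  above. Since \<open>norm (a - b) \<le> norm a + norm b\<close>, a factor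
  \<open>norm (a - b)\<close> cancels.\<close>

lemma norm_diff_sq_le_norm_signed_sq:
  fixes a b :: "'b::real_inner"
  shows "(norm (a - b))\<^sup>2 \<le> 2 * norm (norm a *\<^sub>R a - norm b *\<^sub>R b)"
proof (cases "a = b")
  case False
  let ?A = "norm a" and ?B = "norm b" and ?w = "norm a *\<^sub>R a - norm b *\<^sub>R b"
  have ab: "(norm (a - b))\<^sup>2 = ?A\<^sup>2 + ?B\<^sup>2 - 2 * (a \<bullet> b)"
    by (simp add: power2_norm_eq_inner inner_simps inner_commute)
  have "inner ?w (a - b) = ?A * ?A\<^sup>2 + ?B * ?B\<^sup>2 - (?A + ?B) * (a \<bullet> b)"
    by (simp add: power2_norm_eq_inner inner_simps inner_commute algebra_simps)
  also have "\<dots> = (?A + ?B) * (norm (a - b))\<^sup>2 / 2 + (?A - ?B)\<^sup>2 * (?A + ?B) / 2"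
    unfolding ab by (simp add: field_simps power2_eq_square)
  also have "\<dots> \<ge> (?A + ?B) * (norm (a - b))\<^sup>2 / 2"
    by simp
  finally have "(?A + ?B) * (norm (a - b))\<^sup>2 / 2 \<le> norm ?w * norm (a - b)"
    using norm_cauchy_schwarz[of ?w "a - b"] by linarith
  moreover have "norm (a - b) * (norm (a - b))\<^sup>2 / 2 \<le> (?A + ?B) * (norm (a - b))\<^sup>2 / 2"
    by (intro divide_right_mono mult_right_mono norm_triangle_ineq4) auto
  ultimately have "norm (a - b) * (norm (a - b))\<^sup>2 \<le> norm (a - b) * (2 * norm ?w)"
    by (simp add: mult.commute)
  then show ?thesis
    using False by (simp add: mult_le_cancel_left)
qed simp

text \<open>Reduces inner products to squared norms, for which isometry statements are
  available.\<close>

lemma Re_mult_cnj_polarization: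
  "Re (a * cnj b) = ((norm a)\<^sup>2 + (norm b)\<^sup>2 - (norm (a - b))\<^sup>2) / 2"
  unfolding cmod_power2 by (simp add: power2_eq_square field_simps)

lemma norm_diff_sq_le: "(norm (a - b))\<^sup>2 \<le> 2 * (norm a)\<^sup>2 + 2 * (norm b)\<^sup>2"
proof -
  have "(norm (a - b))\<^sup>2 \<le> (norm a + norm b)\<^sup>2"
    by (intro power_mono norm_triangle_ineq4) auto
  also have "\<dots> \<le> 2 * (norm a)\<^sup>2 + 2 * (norm b)\<^sup>2"
    using sum_squares_bound[of "norm a" "norm b"] by (simp add: power2_sum)
  finally show ?thesis .
qed

lemma integrable_norm_diff_sq:
  fixes f g :: "'a \<Rightarrow> 'b::{real_normed_vector,second_countable_topology}"
  assumes [measurable]: "f \<in> borel_measurable M" "g \<in> borel_measurable M"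
    and "integrable M (\<lambda>x. (norm (f x))\<^sup>2)" "integrable M (\<lambda>x. (norm (g x))\<^sup>2)"
  shows "integrable M (\<lambda>x. (norm (f x - g x))\<^sup>2)"
proof (rule Bochner_Integration.integrable_bound)
  show "integrable M (\<lambda>x. 2 * (norm (f x))\<^sup>2 + 2 * (norm (g x))\<^sup>2)"
    using assms by simp
qed (use norm_diff_sq_le in auto)

lemma integrable_norm_mult_of_squares:
  fixes f g :: "'a \<Rightarrow> 'b::{real_normed_div_algebra,second_countable_topology,banach}"
  assumes [measurable]: "f \<in> borel_measurable M" "g \<in> borel_measurable M"
    and "integrable M (\<lambda>x. (norm (f x))\<^sup>2)" "integrable M (\<lambda>x. (norm (g x))\<^sup>2)"
  shows "integrable M (\<lambda>x. f x * g x)"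
proof (rule Bochner_Integration.integrable_bound)
  show "integrable M (\<lambda>x. (norm (f x))\<^sup>2 + (norm (g x))\<^sup>2)"
    using assms by simp
  have "norm (f x) * norm (g x) \<le> (norm (f x))\<^sup>2 + (norm (g x))\<^sup>2" for x
  proof -
    have "0 \<le> norm (f x) * norm (g x)" by simp
    then show ?thesis
      using sum_squares_bound[of "norm (f x)" "norm (g x)"] by linarith
  qed
  then show "AE x in M. norm (f x * g x) \<le> norm ((norm (f x))\<^sup>2 + (norm (g x))\<^sup>2)"
    by (auto simp: norm_mult)
qed simp

text \<open>The map \<open>z \<mapsto> \<bar>z\<bar>z\<close> carries \<open>L\<^sup>2\<close> to \<open>L\<^sup>1\<close> and has a Hoelder continuous inverse,
  so continuity of translations in \<open>L\<^sup>2\<close> reduces to that in \<open>L\<^sup>1\<close>.\<close>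

lemma L2_translation_tendsto_0:
  fixes f :: "'a::euclidean_space \<Rightarrow> 'b::{real_inner,banach,second_countable_topology}"
  assumes [measurable]: "f \<in> borel_measurable borel"
    and f2: "integrable lborel (\<lambda>x. (norm (f x))\<^sup>2)" and h: "h \<longlonglongrightarrow> 0"
  shows "(\<lambda>k. LINT x|lborel. (norm (f (h k + x) - f x))\<^sup>2) \<longlonglongrightarrow> 0"
proof -
  let ?g = "\<lambda>x. norm (f x) *\<^sub>R f x"
  have g: "integrable lborel ?g"
    by (rule Bochner_Integration.integrable_bound[OF f2]) (auto simp: power2_eq_square)
  have "(\<lambda>k. 2 * (LINT x|lborel. norm (?g (h k + x) - ?g x))) \<longlonglongrightarrow> 2 * 0"
    by (intro tendsto_intros L1_translation_tendsto_0 g h)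
  then have lim: "(\<lambda>k. LINT x|lborel. 2 * norm (?g (h k + x) - ?g x)) \<longlonglongrightarrow> 0"
    by simp
  show ?thesis
  proof (rule tendsto_sandwich[OF _ _ tendsto_const lim])
    show "\<forall>\<^sub>F k in sequentially. (LINT x|lborel. (norm (f (h k + x) - f x))\<^sup>2)
        \<le> (LINT x|lborel. 2 * norm (?g (h k + x) - ?g x))"
    proof (intro always_eventually allI integral_mono)
      fix k
      show "integrable lborel (\<lambda>x. (norm (f (h k + x) - f x))\<^sup>2)"
        using lborel_integrable_translation[OF f2] by (intro integrable_norm_diff_sq f2) auto
      show "integrable lborel (\<lambda>x. 2 * norm (?g (h k + x) - ?g x))"
        using lborel_integrable_translation[OF g, of "h k"] g
        by (intro integrable_mult_right integrable_norm Bochner_Integration.integrable_diff)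
    qed (rule norm_diff_sq_le_norm_signed_sq)
  qed simp
qed

section \<open>Gaussian regularization and Plancherel's identity\<close>

lemma norm_fourier_le: "norm (fourier f \<xi>) \<le> (LINT x|lborel. norm (f x))"
  unfolding fourier_def using integral_norm_bound[of lborel "\<lambda>x. f x * fourier_char \<xi> x"]
  by (simp add: norm_mult)

lemma integral_gaussian: "(LINT x::'a::euclidean_space|lborel. exp (- pi * (norm x)\<^sup>2)) = 1"
proof -
  have "complex_of_real (LINT x::'a|lborel. exp (- pi * (norm x)\<^sup>2)) = 1"
    using gaussian_fourier(2)[of "0::'a"] by (simp add: fourier_def flip: integral_complex_of_real)
  then show ?thesis by (simp only: of_real_eq_1_iff)
qed

text \<open>The multiplication formula for \<open>A\<close> and a dilated Gaussian. As
  \<open>s\<close> tends to 0 the left side formally becomes the integral of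
  \<open>fourier A\<close> and the right side \<open>A 0\<close>: a regularized inversion at the
  origin that makes sense before \<open>fourier A\<close> is known to be integrable.\<close>

lemma gaussian_regularization:
  fixes A :: "'a::euclidean_space \<Rightarrow> complex"
  assumes A: "integrable lborel A" and s: "s > 0"
  shows "(LINT \<xi>|lborel. of_real (exp (- pi * (norm (s *\<^sub>R \<xi>))\<^sup>2)) * fourier A \<xi>)
       = (LINT t|lborel. of_real (exp (- pi * (norm t)\<^sup>2)) * A (s *\<^sub>R t))"
proof -
  let ?E = "\<lambda>x::'a. complex_of_real (exp (- pi * (norm x)\<^sup>2))"
  have E: "integrable lborel ?E"
    using gaussian_fourier(1) by (rule integrable_of_real)
  have Es: "integrable lborel (\<lambda>\<xi>. ?E (s *\<^sub>R \<xi>))"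
    using lborel_integrable_affine[OF E, of s 0] s by simp
  \<comment> \<open>The Gaussian is its own transform, so dilating it by \<open>s\<close> costs a
    factor \<open>s ^ DIM('a)\<close>; the Jacobian of the substitution by
    \<open>s *\<^sub>R t\<close> below absorbs it.\<close>
  have FEs: "?E t = s ^ DIM('a) *\<^sub>R fourier (\<lambda>\<xi>. ?E (s *\<^sub>R \<xi>)) (s *\<^sub>R t)" for t
  proof -
    have "?E t = fourier ?E t"
      by (simp only: gaussian_fourier(2))
    also have "\<dots> = \<bar>s\<bar> ^ DIM('a) *\<^sub>R (LINT x|lborel. ?E (0 + s *\<^sub>R x) * fourier_char t (0 + s *\<^sub>R x))"
      unfolding fourier_def by (rule lborel_integral_affine) (use s in simp)
    finally show ?thesis
      using s by (simp add: fourier_def)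
  qed
  have "(LINT \<xi>|lborel. ?E (s *\<^sub>R \<xi>) * fourier A \<xi>)
      = (LINT x|lborel. fourier (\<lambda>\<xi>. ?E (s *\<^sub>R \<xi>)) x * A x)"
    by (rule fourier_multiplication_formula[OF Es A])
  also have "\<dots> = s ^ DIM('a) *\<^sub>R (LINT t|lborel. fourier (\<lambda>\<xi>. ?E (s *\<^sub>R \<xi>)) (s *\<^sub>R t) * A (s *\<^sub>R t))"
    using lborel_integral_affine[of s "\<lambda>x. fourier (\<lambda>\<xi>. ?E (s *\<^sub>R \<xi>)) x * A x" 0] s by simp
  also have "\<dots> = (LINT t|lborel. ?E t * A (s *\<^sub>R t))"
    unfolding integral_scaleR_right[symmetric]
    by (intro Bochner_Integration.integral_cong refl, subst FEs) simp
  finally show ?thesis .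
qed

text \<open>The autocorrelation \<open>A\<close> of \<open>f\<close> has Fourier transform \<open>\<bar>fourier f\<bar>\<^sup>2\<close> and real part
  \<open>\<parallel>f\<parallel>\<^sup>2 - \<parallel>\<tau>\<^sub>t f - f\<parallel>\<^sup>2 / 2\<close>; integrate both against Gaussians concentrating at \<open>0\<close>.\<close>

lemma plancherel:
  fixes f :: "'a::euclidean_space \<Rightarrow> complex"
  assumes f1: "integrable lborel f" and f2: "integrable lborel (\<lambda>x. (norm (f x))\<^sup>2)"
  shows "(\<integral>\<^sup>+\<xi>. ennreal ((norm (fourier f \<xi>))\<^sup>2) \<partial>lborel) = (\<integral>\<^sup>+x. ennreal ((norm (f x))\<^sup>2) \<partial>lborel)"
proof -
  have fm[measurable]: "f \<in> borel_measurable borel"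
    using f1 by auto
  have [measurable]: "(\<lambda>x. cnj (f x)) \<in> borel_measurable borel"
    using borel_measurable_integrable[OF integrable_cnj[OF f1]] by simp
  note [measurable] = borel_measurable_fourier[OF fm]
  define f' where "f' = (\<lambda>y. cnj (f (- y)))"
  define A where "A = (\<lambda>t. LINT y|lborel. f (t - y) * f' y)"
  define N where "N = (LINT x|lborel. (norm (f x))\<^sup>2)"
  define D where "D = (\<lambda>t. LINT x|lborel. (norm (f (t + x) - f x))\<^sup>2)"
  have f'1: "integrable lborel f'"
    unfolding f'_def using lborel_integrable_reflection[OF f1, of 0] by (simp add: integrable_cnj)
  have A1: "integrable lborel A"
    unfolding A_def by (rule integrable_convolution[OF f1 f'1])
  have "fourier f' \<xi> = cnj (fourier f \<xi>)" for \<xi>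
  proof -
    have "fourier f' \<xi> = (LINT y|lborel. cnj (f (0 - y) * fourier_char \<xi> (0 - y)))"
      unfolding fourier_def f'_def by (simp add: exp_cnj)
    also have "\<dots> = (LINT y|lborel. cnj (f y * fourier_char \<xi> y))"
      by (rule lborel_integral_reflection[of "\<lambda>y. cnj (f y * fourier_char \<xi> y)"])
    finally show ?thesis
      by (simp add: fourier_def integrable_mult_fourier_char[OF f1] del: complex_cnj_mult)
  qed
  then have FA: "fourier A \<xi> = of_real ((norm (fourier f \<xi>))\<^sup>2)" for \<xi>
    unfolding A_def by (subst fourier_convolution[OF f1 f'1]) (simp only: complex_norm_square)
  have ft2: "integrable lborel (\<lambda>x. (norm (f (t + x)))\<^sup>2)" for t
    using lborel_integrable_translation[OF f2] by simp
  have Dint: "integrable lborel (\<lambda>x. (norm (f (t + x) - f x))\<^sup>2)" for t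
    by (intro integrable_norm_diff_sq f2 ft2) auto
  have Nt: "(LINT x|lborel. (norm (f (t + x)))\<^sup>2) = N" for t
    unfolding N_def by (rule lborel_integral_translation[of "\<lambda>x. (norm (f x))\<^sup>2"])
  have ReA: "Re (A t) = N - D t / 2" for t
  proof -
    have "A t = (LINT y|lborel. f (t + (0 - y)) * cnj (f (0 - y)))"
      by (simp add: A_def f'_def)
    also have "\<dots> = (LINT y|lborel. f (t + y) * cnj (f y))"
      by (rule lborel_integral_reflection[of "\<lambda>y. f (t + y) * cnj (f y)"])
    finally have "Re (A t) = (LINT y|lborel. Re (f (t + y) * cnj (f y)))"
      by (subst integral_Re) (auto intro!: integrable_norm_mult_of_squares f2 ft2)
    also have "\<dots> = (LINT y|lborel. ((norm (f (t + y)))\<^sup>2 + (norm (f y))\<^sup>2 - (norm (f (t + y) - f y))\<^sup>2) / 2)"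
      by (simp only: Re_mult_cnj_polarization)
    also have "\<dots> = N - D t / 2"
      using Nt[of t] Nt[of 0] ft2[of t] f2 Dint[of t] by (simp add: D_def)
    finally show ?thesis .
  qed
  have D0: "0 \<le> D t" for t
    by (simp add: D_def)
  \<comment> \<open>With \<open>D0\<close> this gives \<open>\<bar>N - D t / 2\<bar> \<le> N\<close>
    uniformly in \<open>t\<close>, which supplies the dominating function \<open>?E t * N\<close>
    below.\<close>
  have D4: "D t \<le> 4 * N" for t
  proof -
    have "D t \<le> (LINT x|lborel. 2 * (norm (f (t + x)))\<^sup>2 + 2 * (norm (f x))\<^sup>2)"
      unfolding D_def using Dint ft2 f2 by (intro integral_mono norm_diff_sq_le) auto
    also have "\<dots> = 4 * N"
      using Nt[of t] Nt[of 0] ft2[of t] f2 by simp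
    finally show ?thesis .
  qed
  have [measurable]: "D \<in> borel_measurable borel"
    unfolding D_def by measurable
  let ?E = "\<lambda>x::'a. exp (- pi * (norm x)\<^sup>2)"
  define s where "s k = inverse (real (Suc k))" for k
  have s: "s k > 0" for k by (simp add: s_def)
  have s0: "s \<longlonglongrightarrow> 0" unfolding s_def by (rule LIMSEQ_inverse_real_of_nat)
  have reg: "(LINT \<xi>|lborel. ?E (s k *\<^sub>R \<xi>) * (norm (fourier f \<xi>))\<^sup>2)
      = (LINT t|lborel. ?E t * (N - D (s k *\<^sub>R t) / 2))" for k
  proof -
    have int: "integrable lborel (\<lambda>t. complex_of_real (?E t) * A (s k *\<^sub>R t))"
    proof (rule Bochner_Integration.integrable_bound)
      show "integrable lborel (\<lambda>t. A (s k *\<^sub>R t))"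
        using lborel_integrable_affine[OF A1, of "s k" 0] s[of k] by simp
      then show "(\<lambda>t. complex_of_real (?E t) * A (s k *\<^sub>R t)) \<in> borel_measurable lborel"
        by (intro borel_measurable_times) auto
    qed (auto simp: norm_mult mult_left_le_one_le)
    have "complex_of_real (LINT \<xi>|lborel. ?E (s k *\<^sub>R \<xi>) * (norm (fourier f \<xi>))\<^sup>2)
       = (LINT \<xi>|lborel. of_real (?E (s k *\<^sub>R \<xi>)) * fourier A \<xi>)"
      unfolding FA of_real_mult[symmetric] by (rule integral_complex_of_real[symmetric])
    also have "\<dots> = (LINT t|lborel. of_real (?E t) * A (s k *\<^sub>R t))"
      by (rule gaussian_regularization[OF A1 s])
    finally have eq: "complex_of_real (LINT \<xi>|lborel. ?E (s k *\<^sub>R \<xi>) * (norm (fourier f \<xi>))\<^sup>2)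
       = (LINT t|lborel. of_real (?E t) * A (s k *\<^sub>R t))" .
    have "(LINT \<xi>|lborel. ?E (s k *\<^sub>R \<xi>) * (norm (fourier f \<xi>))\<^sup>2)
      = Re (LINT t|lborel. of_real (?E t) * A (s k *\<^sub>R t))"
      by (simp only: eq[symmetric] Re_complex_of_real)
    also have "\<dots> = (LINT t|lborel. Re (of_real (?E t) * A (s k *\<^sub>R t)))"
      by (rule integral_Re[OF int, symmetric])
    finally show ?thesis by (simp add: ReA)
  qed
  have lim: "(\<lambda>k. LINT t|lborel. ?E t * (N - D (s k *\<^sub>R t) / 2)) \<longlonglongrightarrow> (LINT t|lborel. ?E t * N)"
  proof (rule integral_dominated_convergence[where w="\<lambda>t. ?E t * N"])
    show "integrable lborel (\<lambda>t. ?E t * N)"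
      using gaussian_fourier(1) by (rule integrable_mult_left)
    show "AE t in lborel. (\<lambda>k. ?E t * (N - D (s k *\<^sub>R t) / 2)) \<longlonglongrightarrow> ?E t * N"
    proof (rule AE_I2)
      fix t :: 'a
      have "(\<lambda>k. s k *\<^sub>R t) \<longlonglongrightarrow> 0"
        using tendsto_scaleR[OF s0 tendsto_const[of t]] by simp
      then have "(\<lambda>k. D (s k *\<^sub>R t)) \<longlonglongrightarrow> 0"
        unfolding D_def by (intro L2_translation_tendsto_0 f2 fm)
      then have "(\<lambda>k. ?E t * (N - D (s k *\<^sub>R t) / 2)) \<longlonglongrightarrow> ?E t * (N - 0 / 2)"
        by (intro tendsto_intros) auto
      then show "(\<lambda>k. ?E t * (N - D (s k *\<^sub>R t) / 2)) \<longlonglongrightarrow> ?E t * N" by simp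
    qed
    fix k
    show "AE t in lborel. norm (?E t * (N - D (s k *\<^sub>R t) / 2)) \<le> ?E t * N"
    proof (rule AE_I2)
      fix t :: 'a
      have "\<bar>N - D (s k *\<^sub>R t) / 2\<bar> \<le> N"
        using D0[of "s k *\<^sub>R t"] D4[of "s k *\<^sub>R t"] by linarith
      then show "norm (?E t * (N - D (s k *\<^sub>R t) / 2)) \<le> ?E t * N"
        by (simp add: abs_mult)
    qed
  qed auto
  also have "(LINT t|lborel. ?E t * N) = N"
    using integral_gaussian[where 'a='a] by simp
  finally have lim1: "(\<lambda>k. ennreal (LINT \<xi>|lborel. ?E (s k *\<^sub>R \<xi>) * (norm (fourier f \<xi>))\<^sup>2)) \<longlonglongrightarrow> ennreal N"
    unfolding reg by (rule tendsto_ennrealI)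
  \<comment> \<open>\<open>fourier f\<close> is bounded by the L^1 norm of \<open>f\<close>, so the
    Gaussian alone makes the product integrable.\<close>
  have int: "integrable lborel (\<lambda>\<xi>. ?E (s k *\<^sub>R \<xi>) * (norm (fourier f \<xi>))\<^sup>2)" for k
  proof (rule Bochner_Integration.integrable_bound)
    show "integrable lborel (\<lambda>\<xi>. ?E (s k *\<^sub>R \<xi>) * (LINT x|lborel. norm (f x))\<^sup>2)"
      using lborel_integrable_affine[OF gaussian_fourier(1), of "s k" "0::'a"] s[of k] by simp
    show "AE x in lborel. norm (?E (s k *\<^sub>R x) * (cmod (fourier f x))\<^sup>2)
         \<le> norm (?E (s k *\<^sub>R x) * (LINT x|lborel. cmod (f x))\<^sup>2)"
      by (auto intro!: AE_I2 mult_left_mono power_mono norm_fourier_le simp: abs_mult)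
  qed measurable
  have "(\<lambda>k. \<integral>\<^sup>+\<xi>. ennreal (?E (s k *\<^sub>R \<xi>) * (norm (fourier f \<xi>))\<^sup>2) \<partial>lborel)
      \<longlonglongrightarrow> (\<integral>\<^sup>+\<xi>. ennreal ((norm (fourier f \<xi>))\<^sup>2) \<partial>lborel)"
  proof (rule nn_integral_LIMSEQ)
    \<comment> \<open>A smaller \<open>s k\<close> gives a larger Gaussian. Monotone convergence is
      used because an integrable majorant would presuppose that \<open>fourier f\<close> is square
      integrable.\<close>
    show "incseq (\<lambda>k \<xi>. ennreal (?E (s k *\<^sub>R \<xi>) * (norm (fourier f \<xi>))\<^sup>2))"
    proof (intro incseq_SucI le_funI ennreal_leI mult_right_mono)
      fix k and \<xi> :: 'a
      have "s (Suc k) \<le> s k" unfolding s_def by (intro le_imp_inverse_le) auto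
      then have "(norm (s (Suc k) *\<^sub>R \<xi>))\<^sup>2 \<le> (norm (s k *\<^sub>R \<xi>))\<^sup>2"
        using s[of k] s[of "Suc k"] by (intro power_mono) (auto intro!: mult_right_mono)
      then show "?E (s k *\<^sub>R \<xi>) \<le> ?E (s (Suc k) *\<^sub>R \<xi>)" by simp
    qed simp
    fix \<xi> :: 'a
    have "(\<lambda>k. s k *\<^sub>R \<xi>) \<longlonglongrightarrow> 0"
      using tendsto_scaleR[OF s0 tendsto_const[of \<xi>]] by simp
    then have "(\<lambda>k. ?E (s k *\<^sub>R \<xi>) * (norm (fourier f \<xi>))\<^sup>2) \<longlonglongrightarrow> ?E 0 * (norm (fourier f \<xi>))\<^sup>2"
      by (intro tendsto_intros)
    then show "(\<lambda>k. ennreal (?E (s k *\<^sub>R \<xi>) * (norm (fourier f \<xi>))\<^sup>2)) \<longlonglongrightarrow> ennreal ((norm (fourier f \<xi>))\<^sup>2)"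
      by (intro tendsto_ennrealI) simp
  qed measurable
  then have "(\<lambda>k. ennreal (LINT \<xi>|lborel. ?E (s k *\<^sub>R \<xi>) * (norm (fourier f \<xi>))\<^sup>2))
      \<longlonglongrightarrow> (\<integral>\<^sup>+\<xi>. ennreal ((norm (fourier f \<xi>))\<^sup>2) \<partial>lborel)"
    by (subst (asm) nn_integral_eq_integral[OF int]) auto
  then have "(\<integral>\<^sup>+\<xi>. ennreal ((norm (fourier f \<xi>))\<^sup>2) \<partial>lborel) = ennreal N"
    using lim1 LIMSEQ_unique by blast
  also have "\<dots> = (\<integral>\<^sup>+x. ennreal ((norm (f x))\<^sup>2) \<partial>lborel)"
    unfolding N_def by (rule nn_integral_eq_integral[OF f2, symmetric]) simp
  finally show ?thesis .
qed

section \<open>The Fourier transform on \<open>L\<^sup>2\<close>\<close>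

lemma Lp_1_iff:
  fixes f :: "'a::euclidean_space \<Rightarrow> 'b::{banach,second_countable_topology}"
  shows "f \<in> Lp 1 \<longleftrightarrow> integrable lborel f"
proof
  assume "f \<in> Lp 1"
  then have "f \<in> borel_measurable lborel" "integrable lborel (\<lambda>x. norm (f x))"
    by (simp_all add: Lp_def)
  then show "integrable lborel f"
    by (simp only: integrable_norm_cancel)
qed (simp add: Lp_def)

lemma Lp_2_iff:
  fixes f :: "'a::euclidean_space \<Rightarrow> 'b::real_normed_vector"
  shows "f \<in> Lp 2 \<longleftrightarrow> f \<in> borel_measurable borel \<and> integrable lborel (\<lambda>x. (norm (f x))\<^sup>2)"
  by (simp add: Lp_def)

lemma Lp_2_diff:
  fixes f g :: "'a::euclidean_space \<Rightarrow> 'b::{real_normed_vector,second_countable_topology}"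
  shows "f \<in> Lp 2 \<Longrightarrow> g \<in> Lp 2 \<Longrightarrow> (\<lambda>x. f x - g x) \<in> Lp 2"
  unfolding Lp_2_iff by (simp add: integrable_norm_diff_sq borel_measurable_diff)

lemma Lp_1_2_diff:
  fixes f g :: "'a::euclidean_space \<Rightarrow> 'b::{banach,second_countable_topology}"
  assumes "f \<in> Lp 1 \<inter> Lp 2" "g \<in> Lp 1 \<inter> Lp 2"
  shows "(\<lambda>x. f x - g x) \<in> Lp 1 \<inter> Lp 2"
  using assms Lp_2_diff[of f g] by (simp add: Lp_1_iff)

lemma plancherel_Lp:
  assumes "f \<in> Lp 1 \<inter> Lp 2"
  shows "fourier f \<in> Lp 2"
    and "(LINT \<xi>|lborel. (norm (fourier f \<xi>))\<^sup>2) = (LINT x|lborel. (norm (f x))\<^sup>2)"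
proof -
  have f: "integrable lborel f" "integrable lborel (\<lambda>x. (norm (f x))\<^sup>2)" "f \<in> borel_measurable borel"
    using assms by (auto simp: Lp_1_iff Lp_2_iff)
  have eq: "(\<integral>\<^sup>+\<xi>. ennreal ((norm (fourier f \<xi>))\<^sup>2) \<partial>lborel) = ennreal (LINT x|lborel. (norm (f x))\<^sup>2)"
    using plancherel[OF f(1,2)] nn_integral_eq_integral[OF f(2)] by simp
  note [measurable] = borel_measurable_fourier[OF f(3)]
  have "integrable lborel (\<lambda>\<xi>. (norm (fourier f \<xi>))\<^sup>2)"
    by (rule integrableI_nonneg) (auto simp: eq)
  then show "fourier f \<in> Lp 2"
    by (simp add: Lp_2_iff)
  show "(LINT \<xi>|lborel. (norm (fourier f \<xi>))\<^sup>2) = (LINT x|lborel. (norm (f x))\<^sup>2)"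
    by (subst integral_eq_nn_integral) (auto simp: eq)
qed

text \<open>A weighted arithmetic-geometric mean inequality bounds the difference of squares
  pointwise by a small multiple of \<open>(norm b)\<^sup>2\<close> plus a large multiple of
  \<open>(norm (a - b))\<^sup>2\<close>; integrating it replaces Minkowski's inequality.\<close>

lemma L2_norm_sq_tendsto:
  fixes p :: "nat \<Rightarrow> 'a::euclidean_space \<Rightarrow> 'b::{real_normed_vector,second_countable_topology}"
  assumes p: "\<And>k. p k \<in> Lp 2" and q: "q \<in> Lp 2"
    and lim: "(\<lambda>k. LINT x|lborel. (norm (p k x - q x))\<^sup>2) \<longlonglongrightarrow> 0"
  shows "(\<lambda>k. LINT x|lborel. (norm (p k x))\<^sup>2) \<longlonglongrightarrow> (LINT x|lborel. (norm (q x))\<^sup>2)"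
proof (rule LIMSEQ_I)
  fix e :: real assume e: "e > 0"
  let ?Q = "LINT x|lborel. (norm (q x))\<^sup>2" and ?R = "\<lambda>k. LINT x|lborel. (norm (p k x - q x))\<^sup>2"
  have Q0: "?Q \<ge> 0" by simp
  \<comment> \<open>Chosen so that \<open>\<delta> * ?Q\<close> uses up at most half of
    \<open>e\<close>; the summand 1 guards against \<open>?Q = 0\<close>.\<close>
  define \<delta> where "\<delta> = e / (2 * (?Q + 1))"
  have \<delta>: "\<delta> > 0" using e Q0 by (simp add: \<delta>_def add_nonneg_pos)
  have \<delta>Q: "\<delta> * ?Q \<le> e / 2"
  proof -
    have "\<delta> * ?Q \<le> \<delta> * (?Q + 1)"
      using \<delta> by (intro mult_left_mono) auto
    also have "\<dots> = e / 2"
    proof -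
      have "e / (2 * c) * c = e / 2" if "c > 0" for c :: real
        using that by simp
      then show ?thesis
        using Q0 by (simp only: \<delta>_def add_nonneg_pos zero_less_one)
    qed
    finally show ?thesis .
  qed
  have pt: "\<bar>(norm a)\<^sup>2 - (norm b)\<^sup>2\<bar> \<le> \<delta> * (norm b)\<^sup>2 + (1 + 1 / \<delta>) * (norm (a - b))\<^sup>2" for a b :: 'b
  proof -
    let ?d = "norm (a - b)"
    have d: "\<bar>norm a - norm b\<bar> \<le> ?d" by (rule norm_triangle_ineq3)
    have "\<bar>(norm a)\<^sup>2 - (norm b)\<^sup>2\<bar> = \<bar>norm a - norm b\<bar> * (norm a + norm b)"
      by (simp add: square_diff_square_factored power2_eq_square abs_mult)
    also have "\<dots> \<le> ?d * (2 * norm b + ?d)"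
      using d by (intro mult_mono) auto
    also have "\<dots> = 2 * (?d / sqrt \<delta>) * (sqrt \<delta> * norm b) + ?d\<^sup>2"
      using \<delta> by (simp add: power2_eq_square algebra_simps)
    also have "\<dots> \<le> (?d / sqrt \<delta>)\<^sup>2 + (sqrt \<delta> * norm b)\<^sup>2 + ?d\<^sup>2"
      using sum_squares_bound[of "?d / sqrt \<delta>" "sqrt \<delta> * norm b"] by simp
    also have "\<dots> = \<delta> * (norm b)\<^sup>2 + (1 + 1 / \<delta>) * ?d\<^sup>2"
      using \<delta> by (simp add: power_divide power_mult_distrib algebra_simps)
    finally show ?thesis .
  qed
  have bound: "\<bar>(LINT x|lborel. (norm (p k x))\<^sup>2) - ?Q\<bar> \<le> \<delta> * ?Q + (1 + 1 / \<delta>) * ?R k" for k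
  proof -
    have i: "integrable lborel (\<lambda>x. (norm (p k x))\<^sup>2)" "integrable lborel (\<lambda>x. (norm (q x))\<^sup>2)"
      "integrable lborel (\<lambda>x. (norm (p k x - q x))\<^sup>2)"
      using p[of k] q Lp_2_diff[OF p q, of k] by (auto simp: Lp_2_iff)
    have "\<bar>(LINT x|lborel. (norm (p k x))\<^sup>2) - ?Q\<bar> = \<bar>LINT x|lborel. (norm (p k x))\<^sup>2 - (norm (q x))\<^sup>2\<bar>"
      using i by simp
    also have "\<dots> \<le> (LINT x|lborel. \<bar>(norm (p k x))\<^sup>2 - (norm (q x))\<^sup>2\<bar>)"
      by (rule integral_abs_bound)
    also have "\<dots> \<le> (LINT x|lborel. \<delta> * (norm (q x))\<^sup>2 + (1 + 1 / \<delta>) * (norm (p k x - q x))\<^sup>2)"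
      using i by (intro integral_mono pt) auto
    also have "\<dots> = \<delta> * ?Q + (1 + 1 / \<delta>) * ?R k"
      using i by simp
    finally show ?thesis .
  qed
  have "(\<lambda>k. (1 + 1 / \<delta>) * ?R k) \<longlonglongrightarrow> (1 + 1 / \<delta>) * 0"
    by (intro tendsto_intros lim)
  from LIMSEQ_D[OF this half_gt_zero[OF e]]
  obtain N where N: "\<And>k. k \<ge> N \<Longrightarrow> norm ((1 + 1 / \<delta>) * ?R k - (1 + 1 / \<delta>) * 0) < e / 2"
    by blast
  show "\<exists>N. \<forall>k\<ge>N. norm ((LINT x|lborel. (norm (p k x))\<^sup>2) - ?Q) < e"
  proof (intro exI[of _ N] allI impI)
    fix k assume "k \<ge> N"
    show "norm ((LINT x|lborel. (norm (p k x))\<^sup>2) - ?Q) < e"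
      using N[OF \<open>k \<ge> N\<close>] bound[of k] \<delta>Q unfolding real_norm_def by linarith
  qed
qed

text \<open>Plancherel for \<open>f k - h\<close> passes to the limit along the sequence that
  witnesses \<open>is_fourier_L2 u v\<close>. It therefore holds for whichever representative
  \<open>v\<close> is chosen.\<close>

lemma fourier_L2_isometry:
  assumes u: "u \<in> Lp 2" and uv: "is_fourier_L2 u v" and h: "h \<in> Lp 1 \<inter> Lp 2"
  shows "(LINT \<xi>|lborel. (norm (v \<xi> - fourier h \<xi>))\<^sup>2) = (LINT x|lborel. (norm (u x - h x))\<^sup>2)"
proof -
  \<comment> \<open>Turns extended integrals into real ones, legitimate since all differences lie in
    L^2. The redundant \<open>h\<close> matches the form needed to apply
    \<open>L2_norm_sq_tendsto\<close> to \<open>p k - h\<close> and \<open>q - h\<close>.\<close>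
  have real_lim: "(\<lambda>k. LINT x|lborel. (norm (p k x - h x - (q x - h x)))\<^sup>2) \<longlonglongrightarrow> 0"
    if "\<And>k. p k \<in> Lp 2" "q \<in> Lp 2" "(\<lambda>k. \<integral>\<^sup>+x. ennreal ((norm (p k x - q x))\<^sup>2) \<partial>lborel) \<longlonglongrightarrow> 0"
    for p :: "nat \<Rightarrow> 'a \<Rightarrow> complex" and q h
  proof -
    have "(\<integral>\<^sup>+x. ennreal ((norm (p k x - q x))\<^sup>2) \<partial>lborel) = ennreal (LINT x|lborel. (norm (p k x - q x))\<^sup>2)" for k
      using Lp_2_diff[OF that(1,2), of k] by (intro nn_integral_eq_integral) (auto simp: Lp_2_iff)
    with that(3) have "(\<lambda>k. ennreal (LINT x|lborel. (norm (p k x - q x))\<^sup>2)) \<longlonglongrightarrow> ennreal 0"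
      by simp
    then show ?thesis
      by (subst (asm) tendsto_ennreal_iff) auto
  qed
  from uv obtain f where v: "v \<in> Lp 2" and f: "\<And>k. f k \<in> Lp 1 \<inter> Lp 2"
    and fu: "(\<lambda>k. \<integral>\<^sup>+x. ennreal ((norm (f k x - u x))\<^sup>2) \<partial>lborel) \<longlonglongrightarrow> 0"
    and fv: "(\<lambda>k. \<integral>\<^sup>+\<xi>. ennreal ((norm (fourier (f k) \<xi> - v \<xi>))\<^sup>2) \<partial>lborel) \<longlonglongrightarrow> 0"
    unfolding is_fourier_L2_def by blast
  have f2: "f k \<in> Lp 2" and h2: "h \<in> Lp 2" for k
    using f h by auto
  note F2 = plancherel_Lp(1)[OF f] and H2 = plancherel_Lp(1)[OF h]
  have "(\<lambda>k. LINT x|lborel. (norm (f k x - h x))\<^sup>2) \<longlonglongrightarrow> (LINT x|lborel. (norm (u x - h x))\<^sup>2)"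
    by (intro L2_norm_sq_tendsto Lp_2_diff f2 h2 u real_lim fu)
  moreover have "(\<lambda>k. LINT \<xi>|lborel. (norm (fourier (f k) \<xi> - fourier h \<xi>))\<^sup>2)
      \<longlonglongrightarrow> (LINT \<xi>|lborel. (norm (v \<xi> - fourier h \<xi>))\<^sup>2)"
    by (intro L2_norm_sq_tendsto Lp_2_diff F2 H2 v real_lim fv)
  moreover have "(LINT \<xi>|lborel. (norm (fourier (f k) \<xi> - fourier h \<xi>))\<^sup>2)
      = (LINT x|lborel. (norm (f k x - h x))\<^sup>2)" for k
    using plancherel_Lp(2)[OF Lp_1_2_diff[OF f h], of k] f[of k] h
    by (simp add: fourier_diff Lp_1_iff)
  ultimately show ?thesis
    using LIMSEQ_unique by fastforce
qed

text \<open>Polarization expresses both sides through three squared norms. Each is preserved: that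
  of \<open>h\<close> by Plancherel, that of \<open>u - h\<close> by the isometry, and that of
  \<open>u\<close> by the isometry with \<open>h = 0\<close>.\<close>

lemma parseval_L2:
  assumes u: "u \<in> Lp 2" and uv: "is_fourier_L2 u v" and h: "h \<in> Lp 1 \<inter> Lp 2"
  shows "(LINT \<xi>|lborel. Re (v \<xi> * cnj (fourier h \<xi>))) = (LINT x|lborel. Re (u x * cnj (h x)))"
proof -
  have v: "v \<in> Lp 2" using uv by (simp add: is_fourier_L2_def)
  have h2: "h \<in> Lp 2" using h by simp
  note H2 = plancherel_Lp(1)[OF h]
  have "(\<lambda>_. 0::complex) \<in> (Lp 1 \<inter> Lp 2 :: ('a \<Rightarrow> complex) set)"
    by (simp add: Lp_1_iff Lp_2_iff)
  from fourier_L2_isometry[OF u uv this]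
  have eq: "(LINT \<xi>|lborel. (norm (v \<xi>))\<^sup>2) = (LINT x|lborel. (norm (u x))\<^sup>2)"
    by (simp add: fourier_def)
  show ?thesis
    unfolding Re_mult_cnj_polarization
    using v u h2 H2 Lp_2_diff[OF v H2] Lp_2_diff[OF u h2] eq plancherel_Lp(2)[OF h] fourier_L2_isometry[OF u uv h]
    by (simp add: Lp_2_iff)
qed

text \<open>Existence of some transform makes the choice in \<open>fourier_L2\<close> meaningful.
  Truncations of \<open>u\<close> to balls have transforms that are Cauchy in L^2; an almost
  everywhere convergent subsequence provides the limit function, and Fatou's lemma gives convergence
  in norm.\<close>

lemma is_fourier_L2_fourier_L2:
  fixes u :: "'a::euclidean_space \<Rightarrow> complex"
  assumes u: "u \<in> Lp 2"
  shows "is_fourier_L2 u (fourier_L2 u)"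
proof -
  have [measurable]: "u \<in> borel_measurable borel" and u2: "integrable lborel (\<lambda>x. (norm (u x))\<^sup>2)"
    using u by (auto simp: Lp_2_iff)
  define f :: "nat \<Rightarrow> 'a \<Rightarrow> complex" where "f k x = indicator (ball 0 (real k)) x *\<^sub>R u x" for k x
  have [measurable]: "ball (0::'a) (real k) \<in> sets borel" for k
    by simp
  have [measurable]: "f k \<in> borel_measurable borel" for k
    unfolding f_def[abs_def] by (intro borel_measurable_scaleR borel_measurable_indicator) simp_all
  have fL: "f k \<in> Lp 1 \<inter> Lp 2" for k
  proof -
    have fm: "integrable lborel (indicator (ball (0::'a) (real k)) :: 'a \<Rightarrow> real)"
      using emeasure_lborel_ball_finite[of "0::'a" "real k"] by simp
    have "integrable lborel (f k)"
    proof (rule Bochner_Integration.integrable_bound)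
      show "integrable lborel (\<lambda>x. indicator (ball (0::'a) (real k)) x + (norm (u x))\<^sup>2)"
        using fm u2 by simp
      have "t \<le> 1 + t\<^sup>2" if "t \<ge> 0" for t :: real
        using sum_squares_bound[of t 1] that by simp
      then show "AE x in lborel. norm (f k x) \<le> norm (indicator (ball 0 (real k)) x + (norm (u x))\<^sup>2)"
        by (auto simp: f_def split: split_indicator)
    qed auto
    moreover have "integrable lborel (\<lambda>x. (norm (f k x))\<^sup>2)"
      by (rule Bochner_Integration.integrable_bound[OF u2]) (auto simp: f_def split: split_indicator)
    ultimately show ?thesis by (simp add: Lp_1_iff Lp_2_iff)
  qed
  then have f1: "integrable lborel (f k)" and f2: "f k \<in> Lp 2" for k
    by (auto simp: Lp_1_iff)
  note F2 = plancherel_Lp(1)[OF fL]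
  have [measurable]: "fourier (f k) \<in> borel_measurable borel" for k
    by (intro borel_measurable_fourier) simp
  define R where "R k = (LINT x|lborel. (norm (f k x - u x))\<^sup>2)" for k
  have Rint: "integrable lborel (\<lambda>x. (norm (f k x - u x))\<^sup>2)" for k
    using Lp_2_diff[OF f2 u] by (simp add: Lp_2_iff)
  have R0: "R \<longlonglongrightarrow> 0"
  proof -
    have "(\<lambda>k. LINT x|lborel. (norm (f k x - u x))\<^sup>2) \<longlonglongrightarrow> (LINT x::'a|lborel. 0)"
    proof (rule integral_dominated_convergence[OF _ _ u2])
      show "AE x in lborel. (\<lambda>k. (norm (f k x - u x))\<^sup>2) \<longlonglongrightarrow> 0"
      proof (rule AE_I2)
        fix x :: 'a
        obtain n :: nat where n: "norm x < real n" using reals_Archimedean2 by blast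
        have "eventually (\<lambda>k. (norm (f k x - u x))\<^sup>2 = 0) sequentially"
          using eventually_ge_at_top[of n]
        proof eventually_elim
          case (elim k)
          then have "norm x < real k" using n by linarith
          then show ?case by (simp add: f_def)
        qed
        then show "(\<lambda>k. (norm (f k x - u x))\<^sup>2) \<longlonglongrightarrow> 0"
          by (rule tendsto_eventually)
      qed
      show "AE x in lborel. norm ((norm (f k x - u x))\<^sup>2) \<le> (norm (u x))\<^sup>2" for k
        by (auto simp: f_def split: split_indicator)
    qed auto
    then show ?thesis by (simp add: R_def[abs_def])
  qed
  have Fdiff: "integrable lborel (\<lambda>\<xi>. (norm (fourier (f i) \<xi> - fourier (f j) \<xi>))\<^sup>2)" for i j
    using Lp_2_diff[OF F2 F2] by (simp add: Lp_2_iff)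
  \<comment> \<open>For \<open>i\<close> and \<open>j\<close> beyond \<open>N\<close> the difference
    \<open>f i - f j\<close> vanishes on the ball of radius \<open>N\<close> and is elsewhere 0 or
    \<open>u\<close> up to sign, so \<open>norm (f N x - u x)\<close> dominates it.\<close>
  have FR: "(LINT \<xi>|lborel. (norm (fourier (f i) \<xi> - fourier (f j) \<xi>))\<^sup>2) \<le> R N"
    if "N \<le> i" "N \<le> j" for i j N
  proof -
    have "(LINT \<xi>|lborel. (norm (fourier (f i) \<xi> - fourier (f j) \<xi>))\<^sup>2)
       = (LINT x|lborel. (norm (f i x - f j x))\<^sup>2)"
      using plancherel_Lp(2)[OF Lp_1_2_diff[OF fL fL], of i j] by (simp add: fourier_diff f1)
    also have "\<dots> \<le> R N"
      unfolding R_def using Lp_2_diff[OF f2 f2, of i j] that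
      by (intro integral_mono Rint) (auto simp: f_def Lp_2_iff split: split_indicator)
    finally show ?thesis .
  qed
  \<comment> \<open>The Gaussian weight turns an \<open>L\<^sup>2\<close> Cauchy sequence into an \<open>L\<^sup>1\<close> Cauchy sequence.\<close>
  let ?G = "\<lambda>\<xi>::'a. exp (- pi * (norm \<xi>)\<^sup>2)"
  have G: "integrable lborel ?G" by (rule gaussian_fourier(1))
  \<comment> \<open>The first term integrates to \<open>\<delta>\<close> because the Gaussian has
    total mass 1; the second is controlled in L^2.\<close>
  have Gle: "?G \<xi> * t \<le> \<delta> * ?G \<xi> + t\<^sup>2 / \<delta>" if "t \<ge> 0" "\<delta> > 0" for \<xi> t \<delta>
  proof -
    have "t \<le> \<delta> + t\<^sup>2 / \<delta>"
      using sum_squares_bound[of "sqrt \<delta>" "t / sqrt \<delta>"] that by (simp add: power_divide)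
    then have "?G \<xi> * t \<le> ?G \<xi> * (\<delta> + t\<^sup>2 / \<delta>)"
      by (intro mult_left_mono) auto
    also have "\<dots> = \<delta> * ?G \<xi> + ?G \<xi> * (t\<^sup>2 / \<delta>)" by (simp add: algebra_simps)
    also have "\<dots> \<le> \<delta> * ?G \<xi> + 1 * (t\<^sup>2 / \<delta>)"
      using that by (intro add_left_mono mult_right_mono) auto
    finally show ?thesis by simp
  qed
  have s_int: "integrable lborel (\<lambda>\<xi>. ?G \<xi> *\<^sub>R fourier (f k) \<xi>)" for k
  proof (rule Bochner_Integration.integrable_bound)
    show "integrable lborel (\<lambda>\<xi>. 1 * ?G \<xi> + (norm (fourier (f k) \<xi>))\<^sup>2 / 1)"
      using G F2[of k] by (simp add: Lp_2_iff)
    show "AE \<xi> in lborel. norm (?G \<xi> *\<^sub>R fourier (f k) \<xi>) \<le> norm (1 * ?G \<xi> + (norm (fourier (f k) \<xi>))\<^sup>2 / 1)"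
      using Gle[of "norm (fourier (f k) _)" 1] by (intro AE_I2) (simp add: abs_of_nonneg)
  qed auto
  obtain r where r: "strict_mono r" and AEC: "AE \<xi> in lborel. Cauchy (\<lambda>i. ?G \<xi> *\<^sub>R fourier (f (r i)) \<xi>)"
  proof (rule cauchy_L1_AE_cauchy_subseq[OF s_int])
    fix e :: real assume e: "e > 0"
    \<comment> \<open>With weight \<open>e / 2\<close> in \<open>Gle\<close>, the bound
      \<open>e\<^sup>2 / 4\<close> contributes another \<open>e / 2\<close>.\<close>
    obtain N where N: "norm (R N - 0) < e\<^sup>2 / 4"
      using LIMSEQ_D[OF R0, of "e\<^sup>2 / 4"] e by auto
    show "\<exists>N. \<forall>i\<ge>N. \<forall>j\<ge>N. (LINT \<xi>|lborel. norm (?G \<xi> *\<^sub>R fourier (f i) \<xi> - ?G \<xi> *\<^sub>R fourier (f j) \<xi>)) < e"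
    proof (intro exI[of _ N] allI impI)
      fix i j assume ij: "N \<le> i" "N \<le> j"
      let ?d = "\<lambda>\<xi>. norm (fourier (f i) \<xi> - fourier (f j) \<xi>)"
      have "(LINT \<xi>|lborel. norm (?G \<xi> *\<^sub>R fourier (f i) \<xi> - ?G \<xi> *\<^sub>R fourier (f j) \<xi>))
          \<le> (LINT \<xi>|lborel. e / 2 * ?G \<xi> + (?d \<xi>)\<^sup>2 / (e / 2))"
      proof (rule integral_mono)
        show "integrable lborel (\<lambda>\<xi>. norm (?G \<xi> *\<^sub>R fourier (f i) \<xi> - ?G \<xi> *\<^sub>R fourier (f j) \<xi>))"
          using s_int by (intro integrable_norm Bochner_Integration.integrable_diff)
        show "integrable lborel (\<lambda>\<xi>. e / 2 * ?G \<xi> + (?d \<xi>)\<^sup>2 / (e / 2))"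
          using G Fdiff[of i j] by (intro Bochner_Integration.integrable_add integrable_mult_right integrable_divide)
        fix \<xi>
        show "norm (?G \<xi> *\<^sub>R fourier (f i) \<xi> - ?G \<xi> *\<^sub>R fourier (f j) \<xi>) \<le> e / 2 * ?G \<xi> + (?d \<xi>)\<^sup>2 / (e / 2)"
          using Gle[of "?d \<xi>" "e / 2" \<xi>] e by (simp add: scaleR_diff_right[symmetric])
      qed
      also have "\<dots> = e / 2 * (LINT \<xi>|lborel. ?G \<xi>) + (LINT \<xi>|lborel. (?d \<xi>)\<^sup>2) / (e / 2)"
        using G Fdiff[of i j] by (subst Bochner_Integration.integral_add) auto
      also have "\<dots> = e / 2 + (LINT \<xi>|lborel. (?d \<xi>)\<^sup>2) / (e / 2)"
        unfolding integral_gaussian by simp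
      also have "\<dots> < e / 2 + (e\<^sup>2 / 4) / (e / 2)"
        using FR[OF ij] N e by (intro add_strict_left_mono divide_strict_right_mono) auto
      also have "\<dots> = e" using e by (simp add: power2_eq_square)
      finally show "(LINT \<xi>|lborel. norm (?G \<xi> *\<^sub>R fourier (f i) \<xi> - ?G \<xi> *\<^sub>R fourier (f j) \<xi>)) < e" .
    qed
  qed
  define v where "v \<xi> = lim (\<lambda>i. fourier (f (r i)) \<xi>)" for \<xi>
  have [measurable]: "v \<in> borel_measurable borel"
    unfolding v_def[abs_def] by measurable
  have AEv: "AE \<xi> in lborel. (\<lambda>i. fourier (f (r i)) \<xi>) \<longlonglongrightarrow> v \<xi>"
    using AEC
  proof eventually_elim
    case (elim \<xi>)
    then obtain l where "(\<lambda>i. ?G \<xi> *\<^sub>R fourier (f (r i)) \<xi>) \<longlonglongrightarrow> l"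
      using Cauchy_convergent convergent_def by blast
    \<comment> \<open>The Gaussian never vanishes, so the weight can be divided out.\<close>
    then have "(\<lambda>i. inverse (?G \<xi>) *\<^sub>R (?G \<xi> *\<^sub>R fourier (f (r i)) \<xi>)) \<longlonglongrightarrow> inverse (?G \<xi>) *\<^sub>R l"
      by (intro tendsto_intros)
    then have "(\<lambda>i. fourier (f (r i)) \<xi>) \<longlonglongrightarrow> inverse (?G \<xi>) *\<^sub>R l"
      by simp
    then show ?case
      unfolding v_def by (simp add: limI)
  qed
  \<comment> \<open>Fatou's lemma along the subsequence; \<open>FR\<close> applies with
    \<open>N = j\<close> as soon as \<open>i \<ge> j\<close>, because
    \<open>r i \<ge> i\<close>.\<close>
  have vR: "(\<integral>\<^sup>+\<xi>. ennreal ((norm (fourier (f j) \<xi> - v \<xi>))\<^sup>2) \<partial>lborel) \<le> ennreal (R j)" for j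
  proof -
    have "(\<integral>\<^sup>+\<xi>. ennreal ((norm (fourier (f j) \<xi> - v \<xi>))\<^sup>2) \<partial>lborel)
      = (\<integral>\<^sup>+\<xi>. liminf (\<lambda>i. ennreal ((norm (fourier (f j) \<xi> - fourier (f (r i)) \<xi>))\<^sup>2)) \<partial>lborel)"
    proof (rule nn_integral_cong_AE)
      show "AE \<xi> in lborel. ennreal ((norm (fourier (f j) \<xi> - v \<xi>))\<^sup>2)
         = liminf (\<lambda>i. ennreal ((norm (fourier (f j) \<xi> - fourier (f (r i)) \<xi>))\<^sup>2))"
        using AEv
      proof eventually_elim
        case (elim \<xi>)
        then have "(\<lambda>i. ennreal ((norm (fourier (f j) \<xi> - fourier (f (r i)) \<xi>))\<^sup>2))
            \<longlonglongrightarrow> ennreal ((norm (fourier (f j) \<xi> - v \<xi>))\<^sup>2)"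
          by (intro tendsto_ennrealI tendsto_intros)
        then show ?case
          by (intro lim_imp_Liminf[symmetric]) auto
      qed
    qed
    also have "\<dots> \<le> liminf (\<lambda>i. \<integral>\<^sup>+\<xi>. ennreal ((norm (fourier (f j) \<xi> - fourier (f (r i)) \<xi>))\<^sup>2) \<partial>lborel)"
      by (rule nn_integral_liminf) measurable
    also have "\<dots> \<le> ennreal (R j)"
    proof (rule Liminf_le)
      show "\<forall>\<^sub>F i in sequentially.
         (\<integral>\<^sup>+\<xi>. ennreal ((norm (fourier (f j) \<xi> - fourier (f (r i)) \<xi>))\<^sup>2) \<partial>lborel) \<le> ennreal (R j)"
        using eventually_ge_at_top[of j]
      proof eventually_elim
        case (elim i)
        then have "j \<le> r i" using seq_suble[OF r, of i] by linarith
        then show ?case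
          using FR[of j j "r i"] by (subst nn_integral_eq_integral[OF Fdiff]) (auto intro: ennreal_leI)
      qed
    qed simp
    finally show ?thesis .
  qed
  have "v \<in> Lp 2"
  proof -
    have "integrable lborel (\<lambda>\<xi>. (norm (fourier (f 0) \<xi> - v \<xi>))\<^sup>2)"
      by (rule integrableI_nonneg) (auto intro: le_less_trans[OF vR])
    then have "(\<lambda>\<xi>. fourier (f 0) \<xi> - v \<xi>) \<in> Lp 2"
      by (simp add: Lp_2_iff)
    from Lp_2_diff[OF F2 this, of 0] show ?thesis by simp
  qed
  moreover have "(\<lambda>k. \<integral>\<^sup>+x. ennreal ((norm (f k x - u x))\<^sup>2) \<partial>lborel) \<longlonglongrightarrow> 0"
    using tendsto_ennrealI[OF R0] nn_integral_eq_integral[OF Rint] by (simp add: R_def)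
  moreover have "(\<lambda>k. \<integral>\<^sup>+\<xi>. ennreal ((norm (fourier (f k) \<xi> - v \<xi>))\<^sup>2) \<partial>lborel) \<longlonglongrightarrow> 0"
    by (rule tendsto_sandwich[OF _ _ tendsto_const]) (use vR tendsto_ennrealI[OF R0] in auto)
  ultimately have "is_fourier_L2 u v"
    unfolding is_fourier_L2_def using fL by blast
  then show ?thesis
    unfolding fourier_L2_def by (rule someI[of "is_fourier_L2 u"])
qed

section \<open>The Bessel integral equation\<close>

text \<open>The constant sequence is an admissible approximation. This makes
  \<open>parseval_L2\<close> usable for two functions in L^1 and L^2.\<close>

lemma is_fourier_L2_fourier: "f \<in> Lp 1 \<inter> Lp 2 \<Longrightarrow> is_fourier_L2 f (fourier f)"
  unfolding is_fourier_L2_def using plancherel_Lp(1)[of f] by (auto intro!: exI[of _ "\<lambda>_. f"])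

locale bessel_equation =
  fixes u g :: "'a::euclidean_space \<Rightarrow> real" and \<alpha> q :: real
  assumes alpha_pos: "0 < \<alpha>" and q_pos: "0 < q"
    and kernel: "bessel_kernel \<alpha> g"
    and u_pos: "\<And>x. u x > 0"
    and u_eq: "\<And>x. u x = (LINT y|lborel. g (x - y) * u y powr q)"
begin

section \<open>Integrability and measurability from the integral equation\<close>

lemma kernel_integrable: "integrable lborel g"
  and kernel_pos: "x \<noteq> 0 \<Longrightarrow> 0 < g x"
  and fourier_kernel: "fourier (\<lambda>x. complex_of_real (g x)) \<xi>
      = of_real ((1 + 4 * pi\<^sup>2 * (norm \<xi>)\<^sup>2) powr (- \<alpha> / 2))"
  using kernel unfolding bessel_kernel_def by blast+

lemma kernel_measurable [measurable]: "g \<in> borel_measurable borel"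
  using kernel_integrable by auto

text \<open>A non-integrable right-hand side would have Bochner integral \<open>0\<close>.\<close>

lemma integrand_integrable: "integrable lborel (\<lambda>y. g (x - y) * u y powr q)"
proof (rule ccontr)
  assume "\<not> ?thesis"
  then have "u x = 0"
    by (subst u_eq) (rule not_integrable_integral_eq)
  then show False
    using u_pos[of x] by simp
qed

text \<open>The integrand at \<open>x = 0\<close> is measurable; dividing by the positive kernel and
  taking the \<open>q\<close>-th root recovers \<open>u\<close>. The origin is treated apart, since
  the value \<open>g 0\<close> is arbitrary.\<close>

lemma u_measurable [measurable]: "u \<in> borel_measurable borel"
proof -
  define P where "P = (\<lambda>y. g (0 - y) * u y powr q)"
  have P[measurable]: "P \<in> borel_measurable borel"
    using borel_measurable_integrable[OF integrand_integrable[of 0]] by (simp add: P_def)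
  have "u = (\<lambda>y. (if y = 0 then u 0 powr q else P y / g (0 - y)) powr (1 / q))"
  proof
    fix y
    have "(u y powr q) powr (1 / q) = u y" for y
      using u_pos[of y] q_pos by (simp add: powr_powr)
    then show "u y = (if y = 0 then u 0 powr q else P y / g (0 - y)) powr (1 / q)"
      using kernel_pos[of "- y"] by (auto simp: P_def)
  qed
  moreover have "(\<lambda>y. (if y = 0 then u 0 powr q else P y / g (0 - y)) powr (1 / q)) \<in> borel_measurable borel"
    by measurable
  ultimately show ?thesis by simp
qed

section \<open>Truncated sources and their potentials\<close>

text \<open>\<open>w k\<close> increases to \<open>u\<^sup>q\<close> through bounded functions of bounded support, so that its
  Bessel potential \<open>U k\<close>, which increases to \<open>u\<close>, lies in \<open>L\<^sup>1 \<inter> L\<^sup>2\<close>.\<close>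

definition w :: "nat \<Rightarrow> 'a \<Rightarrow> real" where
  "w k y = indicator (ball 0 (real k)) y * min (u y powr q) (real k)"

definition U :: "nat \<Rightarrow> 'a \<Rightarrow> real" where
  "U k x = (LINT y|lborel. g (x - y) * w k y)"

lemma ball_measurable [measurable]: "ball (0::'a) (real k) \<in> sets borel"
  by simp

lemma w_measurable [measurable]: "w k \<in> borel_measurable borel"
  unfolding w_def[abs_def]
  by (intro borel_measurable_times borel_measurable_indicator ball_measurable) measurable

lemma w_nonneg: "0 \<le> w k y" and w_le: "w k y \<le> u y powr q" and w_le_const: "w k y \<le> real k"
  by (auto simp: w_def split: split_indicator)

lemma w_mono: "j \<le> k \<Longrightarrow> w j y \<le> w k y"
  by (auto simp: w_def split: split_indicator)

lemma w_tendsto: "(\<lambda>k. w k y) \<longlonglongrightarrow> u y powr q"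
proof (rule tendsto_eventually)
  \<comment> \<open>Beyond \<open>n\<close> neither the cut-off in space nor the one in height acts
    at \<open>y\<close>.\<close>
  obtain n :: nat where n: "max (norm y) (u y powr q) < real n"
    using reals_Archimedean2 by blast
  show "\<forall>\<^sub>F k in sequentially. w k y = u y powr q"
    using eventually_ge_at_top[of n]
  proof eventually_elim
    case (elim k)
    then have "norm y < real k" "u y powr q < real k" using n by auto
    then show ?case by (simp add: w_def)
  qed
qed

lemma w_integrable: "integrable lborel (w k)"
proof (rule Bochner_Integration.integrable_bound)
  show "integrable lborel (\<lambda>y. indicator (ball (0::'a) (real k)) y * real k)"
    using emeasure_lborel_ball_finite[of "0::'a" "real k"] by simp
qed (auto simp: w_def split: split_indicator)

lemma kernel_w_integrable: "integrable lborel (\<lambda>y. g (x - y) * w k y)"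
proof (rule Bochner_Integration.integrable_bound[OF integrand_integrable[of x]])
  show "AE y in lborel. norm (g (x - y) * w k y) \<le> norm (g (x - y) * u y powr q)"
    using w_nonneg[of k] w_le[of k] by (auto simp: abs_mult intro!: mult_left_mono)
qed measurable

text \<open>The exceptional point \<open>y = x\<close>, where the kernel may have any sign, is a
  null set; hence the comparisons of potentials below hold almost everywhere under the
  integral.\<close>

lemma AE_kernel_pos: "AE y in lborel. 0 < g (x - y)"
  using AE_lborel_singleton[of x] by eventually_elim (auto intro: kernel_pos)

lemma U_nonneg: "0 \<le> U k x"
  unfolding U_def by (rule integral_nonneg_AE) (use AE_kernel_pos[of x] in eventually_elim, simp add: w_nonneg)

lemma U_mono: "j \<le> k \<Longrightarrow> U j x \<le> U k x"
  unfolding U_def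
  by (rule integral_mono_AE[OF kernel_w_integrable kernel_w_integrable])
     (use AE_kernel_pos[of x] in eventually_elim, simp add: w_mono)

lemma U_le: "U k x \<le> u x"
  unfolding U_def u_eq[of x]
  by (rule integral_mono_AE[OF kernel_w_integrable integrand_integrable])
     (use AE_kernel_pos[of x] in eventually_elim, simp add: w_le)

lemma U_tendsto: "(\<lambda>k. U k x) \<longlonglongrightarrow> u x"
  unfolding U_def u_eq[of x]
proof (rule integral_dominated_convergence)
  show "integrable lborel (\<lambda>y. norm (g (x - y) * u y powr q))"
    using integrand_integrable by (rule integrable_norm)
  show "AE y in lborel. (\<lambda>k. g (x - y) * w k y) \<longlonglongrightarrow> g (x - y) * u y powr q"
    by (intro AE_I2 tendsto_mult tendsto_const w_tendsto)
  show "AE y in lborel. norm (g (x - y) * w k y) \<le> norm (g (x - y) * u y powr q)" for k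
    using w_nonneg[of k] w_le[of k] by (auto simp: abs_mult intro!: mult_left_mono)
qed measurable

lemma U_integrable: "integrable lborel (U k)"
  unfolding U_def[abs_def] by (rule integrable_convolution[OF kernel_integrable w_integrable])

lemma U_measurable [measurable]: "U k \<in> borel_measurable borel"
  using U_integrable[of k] by auto

text \<open>A bounded source gives a bounded potential. Being also integrable, \<open>U k\<close> is
  then square integrable.\<close>

lemma U_bounded: "U k x \<le> real k * (LINT y|lborel. norm (g y))"
proof -
  have "U k x \<le> (LINT y|lborel. norm (g (x - y)) * real k)"
    unfolding U_def
  proof (rule integral_mono[OF kernel_w_integrable])
    show "integrable lborel (\<lambda>y. norm (g (x - y)) * real k)"
      using lborel_integrable_reflection[OF kernel_integrable, of x] by simp
    fix y
    have "g (x - y) * w k y \<le> norm (g (x - y)) * w k y"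
      by (intro mult_right_mono w_nonneg) auto
    also have "\<dots> \<le> norm (g (x - y)) * real k"
      by (intro mult_left_mono w_le_const) auto
    finally show "g (x - y) * w k y \<le> norm (g (x - y)) * real k" .
  qed
  also have "\<dots> = real k * (LINT y|lborel. norm (g y))"
    using lborel_integral_reflection[of "\<lambda>y. norm (g y)" x] by simp
  finally show ?thesis .
qed

lemma U_mult_integrable:
  assumes "integrable lborel f"
  shows "integrable lborel (\<lambda>x. U k x * f x)"
proof (rule Bochner_Integration.integrable_bound)
  show "integrable lborel (\<lambda>x. real k * (LINT y|lborel. norm (g y)) * f x)"
    using assms by simp
  have "\<bar>U k x\<bar> \<le> \<bar>real k * (LINT y|lborel. norm (g y))\<bar>" for x
    using U_bounded[of k x] U_nonneg[of k x] by linarith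
  then show "AE x in lborel. norm (U k x * f x) \<le> norm (real k * (LINT y|lborel. norm (g y)) * f x)"
    by (auto simp only: real_norm_def abs_mult intro!: AE_I2 mult_right_mono)
  show "(\<lambda>x. U k x * f x) \<in> borel_measurable lborel"
    using borel_measurable_integrable[OF assms] by simp
qed

lemma w_Lp: "(\<lambda>x. complex_of_real (w k x)) \<in> Lp 1 \<inter> Lp 2"
proof -
  have "integrable lborel (\<lambda>x. (w k x)\<^sup>2)"
  proof (rule Bochner_Integration.integrable_bound)
    show "integrable lborel (\<lambda>x. real k * w k x)"
      using w_integrable by simp
    show "AE x in lborel. norm ((w k x)\<^sup>2) \<le> norm (real k * w k x)"
      using w_nonneg[of k] w_le_const[of k] by (auto simp: power2_eq_square intro!: mult_right_mono)
  qed measurable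
  then show ?thesis
    using w_integrable[of k] by (simp add: Lp_1_iff Lp_2_iff)
qed

lemma U_Lp: "(\<lambda>x. complex_of_real (U k x)) \<in> Lp 1 \<inter> Lp 2"
  using U_integrable[of k] U_mult_integrable[OF U_integrable[of k], of k]
  by (simp add: Lp_1_iff Lp_2_iff power2_eq_square)

section \<open>The Fourier multiplier and the energy\<close>

definition symbol :: "'a \<Rightarrow> real" where
  "symbol \<xi> = (1 + 4 * pi\<^sup>2 * (norm \<xi>)\<^sup>2) powr (- \<alpha> / 2)"

text \<open>The weight of the Sobolev norm, which is the reciprocal of \<open>symbol\<close>; the
  whole equivalence rests on this duality.\<close>

definition weight :: "'a \<Rightarrow> real" where
  "weight \<xi> = (1 + 4 * pi\<^sup>2 * (norm \<xi>)\<^sup>2) powr (\<alpha> / 2)"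

lemma symbol_measurable [measurable]: "symbol \<in> borel_measurable borel"
  and weight_measurable [measurable]: "weight \<in> borel_measurable borel"
  unfolding symbol_def[abs_def] weight_def[abs_def] by measurable

lemma base_ge_1: "1 \<le> 1 + 4 * pi\<^sup>2 * (norm \<xi>)\<^sup>2"
  by simp

lemma base_nonzero [simp]: "1 + 4 * pi\<^sup>2 * (norm \<xi>)\<^sup>2 \<noteq> 0"
  using base_ge_1[of \<xi>] by linarith

lemma weight_symbol: "weight \<xi> * symbol \<xi> = 1"
  using base_ge_1[of \<xi>] unfolding weight_def symbol_def powr_add[symmetric] by simp

lemma symbol_pos: "0 < symbol \<xi>" and weight_pos: "0 < weight \<xi>"
  using base_ge_1[of \<xi>] by (simp_all add: symbol_def weight_def)

lemma symbol_le_1: "symbol \<xi> \<le> 1"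
  using powr_mono[OF _ base_ge_1, of "- \<alpha> / 2" 0 \<xi>] base_ge_1[of \<xi>] alpha_pos by (simp add: symbol_def)

abbreviation w_hat :: "nat \<Rightarrow> 'a \<Rightarrow> complex" where
  "w_hat k \<equiv> fourier (\<lambda>x. complex_of_real (w k x))"

abbreviation U_hat :: "nat \<Rightarrow> 'a \<Rightarrow> complex" where
  "U_hat k \<equiv> fourier (\<lambda>x. complex_of_real (U k x))"

lemma fourier_U: "U_hat k \<xi> = of_real (symbol \<xi>) * w_hat k \<xi>"
proof -
  have "(\<lambda>x. complex_of_real (U k x)) = (\<lambda>x. LINT y|lborel. complex_of_real (g (x - y)) * complex_of_real (w k y))"
    unfolding U_def by (simp flip: integral_complex_of_real)
  then show ?thesis
    using fourier_convolution[of "\<lambda>x. complex_of_real (g x)" "\<lambda>x. complex_of_real (w k x)" \<xi>]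
      kernel_integrable w_integrable[of k] by (simp add: fourier_kernel symbol_def)
qed

lemma w_hat_measurable [measurable]: "w_hat k \<in> borel_measurable borel"
  by (intro borel_measurable_fourier) measurable

lemma U_hat_measurable [measurable]: "U_hat k \<in> borel_measurable borel"
  by (intro borel_measurable_fourier) measurable

lemma w_hat_energy_integrable: "integrable lborel (\<lambda>\<xi>. symbol \<xi> * (norm (w_hat k \<xi>))\<^sup>2)"
proof (rule Bochner_Integration.integrable_bound)
  show "integrable lborel (\<lambda>\<xi>. (norm (w_hat k \<xi>))\<^sup>2)"
    using plancherel_Lp(1)[OF w_Lp] by (simp add: Lp_2_iff)
  show "AE \<xi> in lborel. norm (symbol \<xi> * (norm (w_hat k \<xi>))\<^sup>2) \<le> norm ((norm (w_hat k \<xi>))\<^sup>2)"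
    using symbol_pos symbol_le_1 by (auto simp: abs_mult less_imp_le intro!: mult_left_le_one_le)
qed measurable

text \<open>The quadratic form of the Bessel kernel at \<open>w k\<close>, that is, the double
  integral of \<open>g (x - y) * w k x * w k y\<close>.\<close>

definition energy :: "nat \<Rightarrow> real" where
  "energy k = (LINT x|lborel. U k x * w k x)"

lemma energy_fourier: "energy k = (LINT \<xi>|lborel. symbol \<xi> * (norm (w_hat k \<xi>))\<^sup>2)"
proof -
  have "Re (U_hat k \<xi> * cnj (w_hat k \<xi>)) = symbol \<xi> * (norm (w_hat k \<xi>))\<^sup>2" for \<xi>
    unfolding fourier_U mult.assoc complex_norm_square[symmetric] by simp
  moreover have "(\<lambda>x. complex_of_real (U k x)) \<in> Lp 2"
    using U_Lp by blast
  ultimately show ?thesis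
    using parseval_L2[OF _ is_fourier_L2_fourier[OF U_Lp] w_Lp, of k k] by (simp add: energy_def)
qed

text \<open>Together with \<open>energy_fourier\<close> this identifies \<open>energy k\<close> with
  the squared Sobolev norm of \<open>U k\<close>.\<close>

lemma weight_U_hat: "weight \<xi> * (norm (U_hat k \<xi>))\<^sup>2 = symbol \<xi> * (norm (w_hat k \<xi>))\<^sup>2"
proof -
  have "weight \<xi> * (norm (U_hat k \<xi>))\<^sup>2 = (weight \<xi> * symbol \<xi>) * symbol \<xi> * (norm (w_hat k \<xi>))\<^sup>2"
    unfolding fourier_U using symbol_pos[of \<xi>] by (simp add: norm_mult power_mult_distrib power2_eq_square)
  then show ?thesis by (simp add: weight_symbol)
qed

text \<open>On the Fourier side the claim is
  \<open>(symbol \<xi>)\<^sup>2 \<le> symbol \<xi>\<close>, which holds because the symbol is at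
  most 1.\<close>

lemma U_L2_le_energy: "(LINT x|lborel. (U k x)\<^sup>2) \<le> energy k"
proof -
  have "(LINT x|lborel. (U k x)\<^sup>2) = (LINT \<xi>|lborel. (norm (U_hat k \<xi>))\<^sup>2)"
    using plancherel_Lp(2)[OF U_Lp, of k] by simp
  also have "\<dots> \<le> (LINT \<xi>|lborel. symbol \<xi> * (norm (w_hat k \<xi>))\<^sup>2)"
  proof (rule integral_mono[OF _ w_hat_energy_integrable])
    show "integrable lborel (\<lambda>\<xi>. (norm (U_hat k \<xi>))\<^sup>2)"
      using plancherel_Lp(1)[OF U_Lp] by (simp add: Lp_2_iff)
    fix \<xi>
    have "(norm (U_hat k \<xi>))\<^sup>2 = symbol \<xi> * (symbol \<xi> * (norm (w_hat k \<xi>))\<^sup>2)"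
      unfolding fourier_U using symbol_pos[of \<xi>] by (simp add: norm_mult power_mult_distrib power2_eq_square)
    also have "\<dots> \<le> symbol \<xi> * (norm (w_hat k \<xi>))\<^sup>2"
      using symbol_pos[of \<xi>] symbol_le_1[of \<xi>] by (intro mult_left_le_one_le) auto
    finally show "(norm (U_hat k \<xi>))\<^sup>2 \<le> symbol \<xi> * (norm (w_hat k \<xi>))\<^sup>2" .
  qed
  finally show ?thesis by (simp add: energy_fourier)
qed

lemma u_mult_powr: "u x * u x powr q = u x powr (q + 1)"
  using u_pos[of x] by (simp add: powr_add)

lemma Uw_integrable: "integrable lborel (\<lambda>x. U k x * w k x)"
  by (rule U_mult_integrable[OF w_integrable])

text \<open>Both factors of the integrand increase. Extended values allow the limit to be infinite,
  so the lemma serves both directions of the equivalence.\<close>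

lemma energy_tendsto: "(\<lambda>k. ennreal (energy k)) \<longlonglongrightarrow> (\<integral>\<^sup>+x. ennreal (u x powr (q + 1)) \<partial>lborel)"
proof -
  have "(\<lambda>k. \<integral>\<^sup>+x. ennreal (U k x * w k x) \<partial>lborel) \<longlonglongrightarrow> (\<integral>\<^sup>+x. ennreal (u x powr (q + 1)) \<partial>lborel)"
  proof (rule nn_integral_LIMSEQ)
    show "incseq (\<lambda>k x. ennreal (U k x * w k x))"
      by (auto intro!: monoI le_funI ennreal_leI mult_mono U_mono w_mono U_nonneg w_nonneg)
    show "(\<lambda>k. ennreal (U k x * w k x)) \<longlonglongrightarrow> ennreal (u x powr (q + 1))" for x
      unfolding u_mult_powr[symmetric] by (intro tendsto_ennrealI tendsto_mult U_tendsto w_tendsto)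
  qed measurable
  moreover have "(\<integral>\<^sup>+x. ennreal (U k x * w k x) \<partial>lborel) = ennreal (energy k)" for k
    unfolding energy_def by (intro nn_integral_eq_integral Uw_integrable) (simp add: U_nonneg w_nonneg)
  ultimately show ?thesis by simp
qed

section \<open>The Sobolev norm bounds the Lebesgue norm\<close>

definition cu :: "'a \<Rightarrow> complex" where
  "cu x = complex_of_real (u x)"

definition V :: "'a \<Rightarrow> complex" where
  "V = fourier_L2 cu"

lemma energy_le_sobolev:
  assumes cu: "cu \<in> Lp 2" and C: "integrable lborel (\<lambda>\<xi>. weight \<xi> * (norm (V \<xi>))\<^sup>2)"
  shows "energy k \<le> (LINT \<xi>|lborel. weight \<xi> * (norm (V \<xi>))\<^sup>2)"
proof -
  let ?C = "LINT \<xi>|lborel. weight \<xi> * (norm (V \<xi>))\<^sup>2"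
  have uV: "is_fourier_L2 cu V"
    unfolding V_def by (rule is_fourier_L2_fourier_L2[OF cu])
  then have "V \<in> Lp 2" by (simp add: is_fourier_L2_def)
  then have V: "V \<in> borel_measurable borel" "integrable lborel (\<lambda>\<xi>. (norm (V \<xi>))\<^sup>2)"
    by (auto simp: Lp_2_iff)
  have w2: "integrable lborel (\<lambda>x. (norm (w k x))\<^sup>2)"
    using w_Lp[of k] by (simp add: Lp_2_iff)
  have wh2: "integrable lborel (\<lambda>\<xi>. (norm (w_hat k \<xi>))\<^sup>2)"
    using plancherel_Lp(1)[OF w_Lp[of k]] by (simp add: Lp_2_iff)
  have u2: "integrable lborel (\<lambda>x. (norm (u x))\<^sup>2)"
    using cu by (simp add: Lp_2_iff cu_def)
  have "energy k \<le> (LINT x|lborel. u x * w k x)"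
    unfolding energy_def
    by (intro integral_mono Uw_integrable integrable_norm_mult_of_squares u2 w2 mult_right_mono U_le w_nonneg) auto
  also have "\<dots> = (LINT x|lborel. Re (cu x * cnj (complex_of_real (w k x))))"
    by (simp add: cu_def)
  also have "\<dots> = (LINT \<xi>|lborel. Re (V \<xi> * cnj (w_hat k \<xi>)))"
    by (rule parseval_L2[OF cu uV w_Lp, symmetric])
  also have "\<dots> \<le> (LINT \<xi>|lborel. (weight \<xi> * (norm (V \<xi>))\<^sup>2 + symbol \<xi> * (norm (w_hat k \<xi>))\<^sup>2) / 2)"
  proof (rule integral_mono)
    have [measurable]: "V \<in> borel_measurable borel" by (rule V)
    have "integrable lborel (\<lambda>\<xi>. (norm (V \<xi> - w_hat k \<xi>))\<^sup>2)"
      by (intro integrable_norm_diff_sq V wh2) (auto simp: V)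
    then show "integrable lborel (\<lambda>\<xi>. Re (V \<xi> * cnj (w_hat k \<xi>)))"
      unfolding Re_mult_cnj_polarization
      by (intro integrable_divide Bochner_Integration.integrable_diff Bochner_Integration.integrable_add V wh2)
    show "integrable lborel (\<lambda>\<xi>. (weight \<xi> * (norm (V \<xi>))\<^sup>2 + symbol \<xi> * (norm (w_hat k \<xi>))\<^sup>2) / 2)"
      by (intro integrable_divide Bochner_Integration.integrable_add C w_hat_energy_integrable)
    fix \<xi>
    \<comment> \<open>Since \<open>weight \<xi> * symbol \<xi> = 1\<close>, inserting the two square
      roots leaves the product unchanged, and
      \<open>2 * ?a * ?b \<le> ?a\<^sup>2 + ?b\<^sup>2\<close> applies.\<close>
    let ?a = "sqrt (weight \<xi>) * norm (V \<xi>)" and ?b = "sqrt (symbol \<xi>) * norm (w_hat k \<xi>)"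
    have "Re (V \<xi> * cnj (w_hat k \<xi>)) \<le> norm (V \<xi> * cnj (w_hat k \<xi>))"
      by (rule complex_Re_le_cmod)
    also have "\<dots> = norm (V \<xi>) * norm (w_hat k \<xi>)"
      by (simp add: norm_mult)
    also have "\<dots> = sqrt (weight \<xi> * symbol \<xi>) * (norm (V \<xi>) * norm (w_hat k \<xi>))"
      by (simp add: weight_symbol)
    also have "\<dots> = (2 * ?a * ?b) / 2"
      by (simp add: real_sqrt_mult)
    also have "\<dots> \<le> (?a\<^sup>2 + ?b\<^sup>2) / 2"
      using sum_squares_bound[of ?a ?b] by simp
    also have "\<dots> = (weight \<xi> * (norm (V \<xi>))\<^sup>2 + symbol \<xi> * (norm (w_hat k \<xi>))\<^sup>2) / 2"
      using weight_pos[of \<xi>] symbol_pos[of \<xi>] by (simp add: power_mult_distrib)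
    finally show "Re (V \<xi> * cnj (w_hat k \<xi>))
        \<le> (weight \<xi> * (norm (V \<xi>))\<^sup>2 + symbol \<xi> * (norm (w_hat k \<xi>))\<^sup>2) / 2" .
  qed
  \<comment> \<open>The finite number \<open>energy k\<close> now stands on both sides, here with
    factor one half, and is absorbed on the left.\<close>
  also have "\<dots> = (?C + energy k) / 2"
    using C w_hat_energy_integrable[of k] by (simp add: energy_fourier)
  finally show ?thesis by simp
qed

text \<open>The bound on the energies is uniform in \<open>k\<close> and survives the limit; a
  finite extended integral then gives integrability.\<close>

lemma sobolev_imp_Lp:
  assumes cu: "cu \<in> Lp 2" and C: "integrable lborel (\<lambda>\<xi>. weight \<xi> * (norm (V \<xi>))\<^sup>2)"
  shows "integrable lborel (\<lambda>x. u x powr (q + 1))"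
    and "(LINT x|lborel. u x powr (q + 1)) \<le> (LINT \<xi>|lborel. weight \<xi> * (norm (V \<xi>))\<^sup>2)"
proof -
  let ?C = "LINT \<xi>|lborel. weight \<xi> * (norm (V \<xi>))\<^sup>2"
  have le: "(\<integral>\<^sup>+x. ennreal (u x powr (q + 1)) \<partial>lborel) \<le> ennreal ?C"
    by (rule LIMSEQ_le_const2[OF energy_tendsto]) (auto intro!: ennreal_leI energy_le_sobolev[OF cu C])
  then show i: "integrable lborel (\<lambda>x. u x powr (q + 1))"
    by (intro integrableI_nonneg) (auto intro: le_less_trans)
  have "0 \<le> ?C"
    using weight_pos by (intro integral_nonneg_AE) (auto simp: less_imp_le)
  then show "(LINT x|lborel. u x powr (q + 1)) \<le> ?C"
    using le by (subst (asm) nn_integral_eq_integral[OF i]) auto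
qed

section \<open>The Lebesgue norm bounds the Sobolev norm\<close>

lemma energy_le_Lp:
  assumes A: "integrable lborel (\<lambda>x. u x powr (q + 1))"
  shows "energy k \<le> (LINT x|lborel. u x powr (q + 1))"
  unfolding energy_def u_mult_powr[symmetric]
proof (rule integral_mono[OF Uw_integrable])
  show "integrable lborel (\<lambda>x. u x * u x powr q)"
    using A by (simp add: u_mult_powr)
  show "U k x * w k x \<le> u x * u x powr q" for x
    using u_pos[of x] by (intro mult_mono U_le w_le w_nonneg) auto
qed

text \<open>The L^2 bound comes through the equation: the energies dominate the squared L^2 norms of
  the \<open>U k\<close>, which increase to that of \<open>u\<close>.\<close>

lemma Lp_imp_L2:
  assumes A: "integrable lborel (\<lambda>x. u x powr (q + 1))"
  shows "cu \<in> Lp 2"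
proof -
  have "(\<lambda>k. \<integral>\<^sup>+x. ennreal ((U k x)\<^sup>2) \<partial>lborel) \<longlonglongrightarrow> (\<integral>\<^sup>+x. ennreal ((u x)\<^sup>2) \<partial>lborel)"
  proof (rule nn_integral_LIMSEQ)
    show "incseq (\<lambda>k x. ennreal ((U k x)\<^sup>2))"
      by (auto intro!: monoI le_funI ennreal_leI power_mono U_mono U_nonneg)
    show "(\<lambda>k. ennreal ((U k x)\<^sup>2)) \<longlonglongrightarrow> ennreal ((u x)\<^sup>2)" for x
      by (intro tendsto_ennrealI tendsto_power U_tendsto)
  qed measurable
  moreover have "(\<integral>\<^sup>+x. ennreal ((U k x)\<^sup>2) \<partial>lborel) \<le> ennreal (LINT x|lborel. u x powr (q + 1))" for k
  proof -
    have "integrable lborel (\<lambda>x. (U k x)\<^sup>2)"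
      using U_Lp[of k] by (simp add: Lp_2_iff)
    then show ?thesis
      using U_L2_le_energy[of k] energy_le_Lp[OF A, of k]
      by (subst nn_integral_eq_integral) (auto intro!: ennreal_leI)
  qed
  ultimately have "(\<integral>\<^sup>+x. ennreal ((u x)\<^sup>2) \<partial>lborel) \<le> ennreal (LINT x|lborel. u x powr (q + 1))"
    by (intro LIMSEQ_le_const2) auto
  then have "integrable lborel (\<lambda>x. (u x)\<^sup>2)"
    by (intro integrableI_nonneg) (auto intro: le_less_trans)
  then show ?thesis
    by (simp add: Lp_2_iff cu_def[abs_def])
qed

lemma Lp_imp_sobolev:
  assumes A: "integrable lborel (\<lambda>x. u x powr (q + 1))"
  shows "integrable lborel (\<lambda>\<xi>. weight \<xi> * (norm (V \<xi>))\<^sup>2)"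
    and "(LINT \<xi>|lborel. weight \<xi> * (norm (V \<xi>))\<^sup>2) \<le> (LINT x|lborel. u x powr (q + 1))"
proof -
  let ?A = "LINT x|lborel. u x powr (q + 1)"
  note cu = Lp_imp_L2[OF A]
  have u2: "integrable lborel (\<lambda>x. (u x)\<^sup>2)"
    using cu by (simp add: Lp_2_iff cu_def)
  have uV: "is_fourier_L2 cu V"
    unfolding V_def by (rule is_fourier_L2_fourier_L2[OF cu])
  then have VL: "V \<in> Lp 2" by (simp add: is_fourier_L2_def)
  then have [measurable]: "V \<in> borel_measurable borel"
    by (simp add: Lp_2_iff)
  \<comment> \<open>Convergence of \<open>U k\<close> to \<open>u\<close> in L^2; since
    \<open>0 \<le> U k x \<le> u x\<close>, the squared error is dominated by
    \<open>(u x)\<^sup>2\<close>.\<close>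
  have "(\<lambda>k. LINT x|lborel. (norm (cu x - complex_of_real (U k x)))\<^sup>2) \<longlonglongrightarrow> (LINT x::'a|lborel. 0)"
  proof (rule integral_dominated_convergence[OF _ _ u2])
    show "AE x in lborel. (\<lambda>k. (norm (cu x - complex_of_real (U k x)))\<^sup>2) \<longlonglongrightarrow> 0"
    proof (rule AE_I2)
      fix x
      have "(\<lambda>k. (norm (cu x - complex_of_real (U k x)))\<^sup>2) \<longlonglongrightarrow> (norm (cu x - complex_of_real (u x)))\<^sup>2"
        by (intro tendsto_intros U_tendsto)
      then show "(\<lambda>k. (norm (cu x - complex_of_real (U k x)))\<^sup>2) \<longlonglongrightarrow> 0"
        by (simp add: cu_def)
    qed
    show "AE x in lborel. norm ((norm (cu x - complex_of_real (U k x)))\<^sup>2) \<le> (u x)\<^sup>2" for k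
    proof (rule AE_I2)
      fix x
      have "\<bar>u x - U k x\<bar> \<le> u x"
        using U_nonneg[of k x] U_le[of k x] by linarith
      then show "norm ((norm (cu x - complex_of_real (U k x)))\<^sup>2) \<le> (u x)\<^sup>2"
        unfolding cu_def of_real_diff[symmetric] norm_of_real by (simp add: abs_le_square_iff[symmetric])
    qed
    show "(\<lambda>x. (norm (cu x - complex_of_real (U k x)))\<^sup>2) \<in> borel_measurable lborel" for k
      unfolding cu_def by measurable
  qed auto
  \<comment> \<open>The isometry moves the convergence to the Fourier side. The outer
    \<open>norm\<close> gives the L^1 form from which an almost everywhere convergent subsequence is
    extracted.\<close>
  then have lim: "(\<lambda>k. LINT \<xi>|lborel. norm ((norm (V \<xi> - U_hat k \<xi>))\<^sup>2)) \<longlonglongrightarrow> 0"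
    using fourier_L2_isometry[OF cu uV U_Lp] by simp
  have "integrable lborel (\<lambda>\<xi>. (norm (V \<xi> - U_hat k \<xi>))\<^sup>2)" for k
    using Lp_2_diff[OF VL plancherel_Lp(1)[OF U_Lp]] by (simp add: Lp_2_iff)
  from tendsto_L1_AE_subseq[OF this lim]
  obtain r where r: "strict_mono r" and AEr: "AE \<xi> in lborel. (\<lambda>k. (norm (V \<xi> - U_hat (r k) \<xi>))\<^sup>2) \<longlonglongrightarrow> 0"
    by blast
  have "(\<integral>\<^sup>+\<xi>. ennreal (weight \<xi> * (norm (V \<xi>))\<^sup>2) \<partial>lborel)
      = (\<integral>\<^sup>+\<xi>. liminf (\<lambda>k. ennreal (weight \<xi> * (norm (U_hat (r k) \<xi>))\<^sup>2)) \<partial>lborel)"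
  proof (rule nn_integral_cong_AE)
    show "AE \<xi> in lborel. ennreal (weight \<xi> * (norm (V \<xi>))\<^sup>2)
        = liminf (\<lambda>k. ennreal (weight \<xi> * (norm (U_hat (r k) \<xi>))\<^sup>2))"
      using AEr
    proof eventually_elim
      case (elim \<xi>)
      have "(\<lambda>k. sqrt ((norm (V \<xi> - U_hat (r k) \<xi>))\<^sup>2)) \<longlonglongrightarrow> sqrt 0"
        using elim by (rule tendsto_real_sqrt)
      then have "(\<lambda>k. V \<xi> - U_hat (r k) \<xi>) \<longlonglongrightarrow> 0"
        by (simp add: tendsto_norm_zero_iff)
      from tendsto_diff[OF tendsto_const[of "V \<xi>"] this]
      have "(\<lambda>k. U_hat (r k) \<xi>) \<longlonglongrightarrow> V \<xi>" by simp
      then have "(\<lambda>k. ennreal (weight \<xi> * (norm (U_hat (r k) \<xi>))\<^sup>2)) \<longlonglongrightarrow> ennreal (weight \<xi> * (norm (V \<xi>))\<^sup>2)"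
        by (intro tendsto_ennrealI tendsto_intros)
      then show ?case
        by (intro lim_imp_Liminf[symmetric]) auto
    qed
  qed
  also have "\<dots> \<le> liminf (\<lambda>k. \<integral>\<^sup>+\<xi>. ennreal (weight \<xi> * (norm (U_hat (r k) \<xi>))\<^sup>2) \<partial>lborel)"
    by (rule nn_integral_liminf) measurable
  \<comment> \<open>By \<open>weight_U_hat\<close> each integral is the energy of
    \<open>U (r k)\<close> on the Fourier side.\<close>
  also have "\<dots> = liminf (\<lambda>k. ennreal (energy (r k)))"
    unfolding weight_U_hat energy_fourier using symbol_pos
    by (subst nn_integral_eq_integral[OF w_hat_energy_integrable]) (auto simp: less_imp_le)
  also have "\<dots> \<le> ennreal ?A"
    by (rule Liminf_le) (auto intro!: always_eventually ennreal_leI energy_le_Lp[OF A])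
  finally have le: "(\<integral>\<^sup>+\<xi>. ennreal (weight \<xi> * (norm (V \<xi>))\<^sup>2) \<partial>lborel) \<le> ennreal ?A" .
  have nn: "AE \<xi> in lborel. 0 \<le> weight \<xi> * (norm (V \<xi>))\<^sup>2"
    using weight_pos by (auto simp: less_imp_le)
  show i: "integrable lborel (\<lambda>\<xi>. weight \<xi> * (norm (V \<xi>))\<^sup>2)"
    by (rule integrableI_nonneg[OF _ nn]) (auto intro: le_less_trans[OF le])
  show "(LINT \<xi>|lborel. weight \<xi> * (norm (V \<xi>))\<^sup>2) \<le> ?A"
    using le by (subst (asm) nn_integral_eq_integral[OF i nn]) auto
qed

section \<open>The equivalence and the identity of norms\<close>

lemma sobolev_iff_Lp: "cu \<in> sobolev (\<alpha> / 2) \<longleftrightarrow> u \<in> Lp (q + 1)"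
proof -
  have "cu \<in> sobolev (\<alpha> / 2) \<longleftrightarrow> cu \<in> Lp 2 \<and> integrable lborel (\<lambda>\<xi>. weight \<xi> * (norm (V \<xi>))\<^sup>2)"
    by (simp add: sobolev_def weight_def V_def)
  also have "\<dots> \<longleftrightarrow> integrable lborel (\<lambda>x. u x powr (q + 1))"
    using sobolev_imp_Lp(1) Lp_imp_L2 Lp_imp_sobolev(1) by blast
  also have "\<dots> \<longleftrightarrow> u \<in> Lp (q + 1)"
    using u_pos by (simp add: Lp_def less_imp_le)
  finally show ?thesis .
qed

lemma sobolev_norm_eq_Lp_norm:
  assumes "u \<in> Lp (q + 1)"
  shows "(sobolev_norm (\<alpha> / 2) cu)\<^sup>2 = Lp_norm (q + 1) u powr (q + 1)"
proof -
  have A: "integrable lborel (\<lambda>x. u x powr (q + 1))"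
    using assms u_pos by (simp add: Lp_def less_imp_le)
  let ?C = "LINT \<xi>|lborel. weight \<xi> * (norm (V \<xi>))\<^sup>2" and ?A = "LINT x|lborel. u x powr (q + 1)"
  \<comment> \<open>Finiteness of \<open>?A\<close> gives that of \<open>?C\<close>, so both
    one-sided bounds apply.\<close>
  have CA: "?C = ?A"
    using Lp_imp_sobolev[OF A] sobolev_imp_Lp(2)[OF Lp_imp_L2[OF A]] by (intro antisym)
  have "(sobolev_norm (\<alpha> / 2) cu)\<^sup>2 = (sqrt ?C)\<^sup>2"
    by (simp add: sobolev_norm_def weight_def V_def)
  also have "\<dots> = ?A"
    by (simp add: CA)
  also have "\<dots> = Lp_norm (q + 1) u powr (q + 1)"
    using u_pos q_pos by (simp add: Lp_norm_def less_imp_le powr_powr)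
  finally show ?thesis .
qed

end

theorem proposition2p7:
  fixes u g :: "real ^ 'n \<Rightarrow> real" and \<alpha> q :: real
  assumes "CARD('n) \<ge> 3"
    and "0 < \<alpha>" and "\<alpha> < real CARD('n)"
    and "q > 1"
    and "bessel_kernel \<alpha> g"
    and "\<And>x. u x > 0"
    and "\<And>x. u x = (LINT y|lborel. g (x - y) * u y powr q)"
  shows "((\<lambda>x. complex_of_real (u x)) \<in> sobolev (\<alpha> / 2) \<longleftrightarrow> u \<in> Lp (q + 1)) \<and>
    (u \<in> Lp (q + 1) \<longrightarrow>
      (sobolev_norm (\<alpha> / 2) (\<lambda>x. complex_of_real (u x)))\<^sup>2 = Lp_norm (q + 1) u powr (q + 1))"
proof -
  interpret bessel_equation u g \<alpha> q
    by (unfold_locales; (rule assms | use assms(4) in linarith))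
  show ?thesis
    using sobolev_iff_Lp sobolev_norm_eq_Lp_norm unfolding cu_def[abs_def] by blast
qed

end
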